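(* Suppose that, for each $i\in\mathcal N$, $f_i:\mathbb R\to\mathbb R$ is continuously differentiable with Lipschitz continuous derivative $\nabla f_i$, that the global cost function $\sum_{i\in\mathcal N} f_i$ is strongly convex, and that the matrix $K$ satisfies $K=K^\top$, $\ker K=\mathrm{span}\,\boldsymbol 1$ and $\sigma(K)\subset[0,1)$. Then there exist $\gamma^\star,\alpha>0$ and, for each $\gamma\in(0,\gamma^\star)$, there exist $\mu_\gamma\in[0,1)$ and $\rho_\gamma,\tau_\gamma>0$, such that, for all $\gamma\in(0,\gamma^\star)$, every solution tuple $(x,z,w,\nu)$ of the system $$x^{t+1}=(I-K)x^t-Kz^t-\gamma\Phi(x^t)+w^t,\qquad z^{t+1}=z^t+Kx^t+\nu^t,\qquad (x^0,z^0)\in\mathbb R^N\times\mathbb R^N,$$ satisfies $$|(x^t,z^t)|_{\mathcal A^\star}\le \alpha\,\mu_\gamma^t\,|(x^0,z^0)|_{\mathcal A^\star}+\rho_\gamma\,|w_{\mathrm m}|_{t-1}+\tau_\gamma\,|(w_\perp,\nu_\perp)|_{t-1}$$ for all $t\in\mathbb N$. In particular, for every $\gamma\in(0,\gamma^\star)$ and every such solution tuple, if $w$ and $\nu$ are bounded, then $x$ and $z_\perp$ are bounded; moreover, in that case, $z_{\mathrm m}$ (hence $(x,z)$) is also bounded if and only if $\nu$ is integral-average bounded.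
   Context: Setting: $\mathbb N=\{0,1,2,\dots\}$. $(\mathcal N,\mathcal E)$ is a connected, undirected, simple graph with $\mathcal N=\{1,\dots,N\}$; $\mathcal N_i=\{j\in\mathcal N: (i,j)\in\mathcal E\}$ (so $i\notin\mathcal N_i$). For each $(i,j)\in\mathcal E$ a coefficient $k_{ij}=k_{ji}>0$ is given, and $K\in\mathbb R^{N\times N}$ is defined by $K_{ij}=-k_{ij}$ if $(i,j)\in\mathcal E$, $K_{ii}=\sum_{j\in\mathcal N_i}k_{ij}$, and $K_{ij}=0$ otherwise. $\sigma(M)$ denotes the spectrum of a matrix $M$. For $x=(x_1,\dots,x_N)\in\mathbb R^N$, $\Phi(x):=(\nabla f_1(x_1),\dots,\nabla f_N(x_N))$. The parameter $\gamma$ is a positive constant. Solution tuple: a tuple $(x,z,w,\nu):\mathbb N\to\mathbb R^{4N}$ (each component being $\mathbb R^N$-valued) satisfying the system for all $t\in\mathbb N$; $s^t$ denotes the value $s(t)$. The sequences $w,\nu$ are perturbations. Average and dispersion components: $\boldsymbol 1=(1,\dots,1)\in\mathbb R^N$, and $S\in\mathbb R^{N\times(N-1)}$ is a fixed matrix with $S^\top\boldsymbol 1=0$ and $S^\top S=I_{N-1}$. For $\chi\in\mathbb R^N$, $\chi_{\mathrm m}:=\boldsymbol 1^\top\chi/N\in\mathbb R$ and $\chi_\perp:=S^\top\chi\in\mathbb R^{N-1}$; this applies pointwise in time to sequences, giving $w_{\mathrm m},w_\perp,\nu_{\mathrm m},\nu_\perp,z_{\mathrm m},z_\perp$. Norms: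 $|\cdot|$ is the Euclidean norm; for a closed set $\mathcal A$, $|x|_{\mathcal A}:=\inf_{a\in\mathcal A}|x-a|$; for a sequence $s$, $|s|_t:=\sup_{k=0,\dots,t}|s(k)|$, with the convention $|s|_{-1}=0$. Target set (depending on $\gamma$; the matrix $S^\top KS$ is invertible under the stated conditions on $K$): $$\mathcal A^\star=\Big\{(x,z)\in\mathbb R^{2N}:\ \exists\,\theta\in\mathbb R,\ \sum_{i\in\mathcal N}\nabla f_i(\theta)=0,\ x=\boldsymbol 1\theta,\ z\in-\gamma S(S^\top KS)^{-1}S^\top\Phi(\boldsymbol 1\theta)+\mathrm{span}\,\boldsymbol 1\Big\}.$$ Integral-average boundedness: $\nu$ is integral-average bounded if $t\mapsto\sum_{s=0}^{t}\nu_{\mathrm m}(s)$ is bounded on $\mathbb N$. *)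

theory Defs
  imports
    "HOL-Analysis.Analysis"
    "Jordan_Normal_Form.Gauss_Jordan_Elimination"
    "Jordan_Normal_Form.Matrix_Kernel"
    "Jordan_Normal_Form.Spectral_Radius"
begin

unbundle no vec_syntax

text \<open>
  Dimensions are explicit natural numbers, because N and N - 1 occur together (and N = 1, for
  which S has no columns, is a legitimate case). The nodes are numbered from 0 to N - 1.
\<close>

definition connected_simple_graph :: "nat \<Rightarrow> (nat \<times> nat) set \<Rightarrow> bool" where
  "connected_simple_graph N E \<longleftrightarrow>
     E \<subseteq> {..<N} \<times> {..<N} \<and> sym E \<and> irrefl E \<and>
     (\<forall>i<N. \<forall>j<N. (i, j) \<in> E\<^sup>*)"

definition weighted_laplacian ::
  "nat \<Rightarrow> (nat \<times> nat) set \<Rightarrow> (nat \<Rightarrow> nat \<Rightarrow> real) \<Rightarrow> real mat" where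
  "weighted_laplacian N E k = mat N N (\<lambda>(i, j).
     if i = j then (\<Sum>l\<in>E `` {i}. k i l)
     else if (i, j) \<in> E then - k i j
     else 0)"

definition ones_vec :: "nat \<Rightarrow> real vec" where
  "ones_vec N = vec N (\<lambda>_. 1)"

definition eucl_norm :: "real vec \<Rightarrow> real" where
  "eucl_norm v = L2_set (\<lambda>i. v $ i) {..<dim_vec v}"

text \<open>Only meaningful for nonempty A: an infimum over the empty set is unspecified.\<close>

definition dist_to_set :: "real vec \<Rightarrow> real vec set \<Rightarrow> real" where
  "dist_to_set v A = (INF a\<in>A. eucl_norm (v - a))"

text \<open>The time index is an integer so that the convention at time -1 can be stated.\<close>

definition running_sup :: "(nat \<Rightarrow> real) \<Rightarrow> int \<Rightarrow> real" where
  "running_sup a t = (if t < 0 then 0 else (SUP k\<in>{0..nat t}. a k))"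

definition vec_seq_bounded :: "(nat \<Rightarrow> real vec) \<Rightarrow> bool" where
  "vec_seq_bounded s \<longleftrightarrow> Bseq (\<lambda>t. eucl_norm (s t))"

definition strongly_convex :: "(real \<Rightarrow> real) \<Rightarrow> bool" where
  "strongly_convex g \<longleftrightarrow> (\<exists>m>0. \<forall>x y. \<forall>u\<in>{0..1}.
     g (u * x + (1 - u) * y)
       \<le> u * g x + (1 - u) * g y - m / 2 * u * (1 - u) * (x - y)\<^sup>2)"

definition C1_lipschitz_deriv :: "(real \<Rightarrow> real) \<Rightarrow> bool" where
  "C1_lipschitz_deriv g \<longleftrightarrow>
     (\<forall>x. g field_differentiable at x) \<and> continuous_on UNIV (deriv g) \<and>
     (\<exists>L. L-lipschitz_on UNIV (deriv g))"

definition grad_vec :: "(nat \<Rightarrow> real \<Rightarrow> real) \<Rightarrow> real vec \<Rightarrow> real vec" where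
  "grad_vec f x = vec (dim_vec x) (\<lambda>i. deriv (f i) (x $ i))"

definition avg_comp :: "nat \<Rightarrow> real vec \<Rightarrow> real" where
  "avg_comp N \<chi> = (ones_vec N \<bullet> \<chi>) / real N"

definition disp_comp :: "real mat \<Rightarrow> real vec \<Rightarrow> real vec" where
  "disp_comp S \<chi> = S\<^sup>T *\<^sub>v \<chi>"

definition dispersion_basis :: "nat \<Rightarrow> real mat \<Rightarrow> bool" where
  "dispersion_basis N S \<longleftrightarrow> S \<in> carrier_mat N (N - 1) \<and>
     S\<^sup>T *\<^sub>v ones_vec N = 0\<^sub>v (N - 1) \<and> S\<^sup>T * S = 1\<^sub>m (N - 1)"

definition solution_tuple ::
  "nat \<Rightarrow> real mat \<Rightarrow> (nat \<Rightarrow> real \<Rightarrow> real) \<Rightarrow> real \<Rightarrow>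
   (nat \<Rightarrow> real vec) \<Rightarrow> (nat \<Rightarrow> real vec) \<Rightarrow> (nat \<Rightarrow> real vec) \<Rightarrow> (nat \<Rightarrow> real vec) \<Rightarrow> bool" where
  "solution_tuple N K f \<gamma> x z w \<nu> \<longleftrightarrow> (\<forall>t.
     x t \<in> carrier_vec N \<and> z t \<in> carrier_vec N \<and>
     w t \<in> carrier_vec N \<and> \<nu> t \<in> carrier_vec N \<and>
     x (Suc t) = (1\<^sub>m N - K) *\<^sub>v x t - K *\<^sub>v z t - \<gamma> \<cdot>\<^sub>v grad_vec f (x t) + w t \<and>
     z (Suc t) = z t + K *\<^sub>v x t + \<nu> t)"

text \<open>
  Pairs of vectors are concatenations. The library's matrix inverse is partial, with result
  None for a singular matrix; here it is applied to an invertible one.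
\<close>

definition target_set ::
  "nat \<Rightarrow> real mat \<Rightarrow> (nat \<Rightarrow> real \<Rightarrow> real) \<Rightarrow> real mat \<Rightarrow> real \<Rightarrow> real vec set" where
  "target_set N K f S \<gamma> = {x @\<^sub>v z | x z. \<exists>\<theta>.
     (\<Sum>i<N. deriv (f i) \<theta>) = 0 \<and>
     x = \<theta> \<cdot>\<^sub>v ones_vec N \<and>
     (\<exists>c. z = (- \<gamma>) \<cdot>\<^sub>v (S * the (mat_inverse (S\<^sup>T * K * S)) * S\<^sup>T
                    *\<^sub>v grad_vec f (\<theta> \<cdot>\<^sub>v ones_vec N))
              + c \<cdot>\<^sub>v ones_vec N)}"

definition integral_average_bounded :: "nat \<Rightarrow> (nat \<Rightarrow> real vec) \<Rightarrow> bool" where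
  "integral_average_bounded N \<nu> \<longleftrightarrow> Bseq (\<lambda>t. \<Sum>s=0..t. avg_comp N (\<nu> s))"

end

theory Submission
  imports Defs
begin

text \<open>
  Strong convexity gives exactly one \<theta> with vanishing total derivative. Along a solution, let m be
  the mean of x minus \<theta>, let u be the mean-free part of x, and let v be the mean-free part of z
  minus the equilibrium offset, the mean-free vector that K maps to the mean-free part of -\<gamma>
  times the gradient at the optimum. K annihilates the constant vectors and its values are
  mean-free, so the mean of z influences none of m, u, v; as the target set also leaves this mean
  free, the distance to the target set is the norm of (x - \<theta> 1, v) (\<open>dist_to_target_set\<close>),
  and it suffices to make (m, u, v) contract.

  Two contractions are at work. The mean performs a scalar gradient step, perturbed by u, which
  contracts by 1 - \<gamma> c / N (\<open>average_step\<close>). The linear part of the dispersion dynamics is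
  (u, v) \<mapsto> (u - K u - K v, v + K u), that is, the identity minus G \<otimes> K, where the 2 by 2
  matrix G with rows (1, 1) and (-1, 0) is a rotation by 60 degrees for the quadratic form
  a^2 + a b + b^2. In the matching form on pairs of vectors each eigenvalue \<kappa> of K
  therefore scales the energy by exactly 1 - \<kappa> + \<kappa>^2 (\<open>hex_energy_step\<close>). On mean-free vectors
  the eigenvalues lie strictly between 0 and 1, so that K - K^2 is coercive there
  (\<open>consensus_gap\<close>) and the dispersion contracts at a rate that does not depend on \<gamma>.

  The two parts are coupled, in both directions, by terms of order \<gamma>. In the Lyapunov function
  |m| + \<beta> |(u, v)| the weight \<beta> is chosen so small, independently of \<gamma>, that the influence
  of m on the dispersion costs only half of the decay of m; for small \<gamma> the fixed decay of the
  dispersion then dominates all terms of order \<gamma> in |(u, v)|, and the whole function contracts by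
  1 - \<gamma> c / (2 N) up to the perturbations (\<open>lyap_step\<close>). Since \<beta> is independent of \<gamma>, so is the
  constant \<alpha> that compares the Lyapunov function with the distance. Iterating gives the estimate.
  Boundedness of x and of the mean-free part of z follows from it, while the mean of z is its
  initial value plus the sum of the means of \<nu>.
\<close>

unbundle no inner_syntax

section \<open>The Euclidean norm\<close>

lemma eucl_norm_nonneg [simp]: "0 \<le> eucl_norm v"
  by (simp add: eucl_norm_def)

lemma eucl_norm_power2: "(eucl_norm v)\<^sup>2 = v \<bullet> v"
  by (simp add: eucl_norm_def L2_set_def scalar_prod_def sum_nonneg power2_eq_square
      lessThan_atLeast0)

lemma scalar_prod_self_nonneg [simp]: "0 \<le> (v :: real vec) \<bullet> v"
  by (metis eucl_norm_power2 zero_le_power2)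

lemma eucl_norm_sqrt: "eucl_norm v = sqrt (v \<bullet> v)"
  by (metis eucl_norm_nonneg eucl_norm_power2 real_sqrt_unique)

lemma scalar_prod_self_eq_0:
  assumes "v \<in> carrier_vec n" "v \<bullet> v = (0::real)"
  shows "v = 0\<^sub>v n"
proof (rule eq_vecI)
  fix i assume "i < dim_vec (0\<^sub>v n)"
  then have i: "i < n" by simp
  have "\<forall>j\<in>{0..<n}. v $ j * v $ j = 0"
    using assms by (subst sum_nonneg_eq_0_iff[symmetric]) (auto simp: scalar_prod_def)
  then show "v $ i = 0\<^sub>v n $ i" using i by simp
qed (use assms in simp)

lemma abs_index_le_eucl_norm: "i < dim_vec v \<Longrightarrow> \<bar>v $ i\<bar> \<le> eucl_norm v"
  using member_le_L2_set[of "{..<dim_vec v}" i "\<lambda>i. \<bar>v $ i\<bar>"]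
  by (simp add: eucl_norm_def L2_set_def)

lemma eucl_norm_triangle:
  assumes "u \<in> carrier_vec n" "v \<in> carrier_vec n"
  shows "eucl_norm (u + v) \<le> eucl_norm u + eucl_norm v"
proof -
  have "eucl_norm (u + v) = L2_set (\<lambda>i. u $ i + v $ i) {..<n}"
    unfolding eucl_norm_def using assms by (intro L2_set_cong) auto
  then show ?thesis
    using L2_set_triangle_ineq[of "\<lambda>i. u $ i" "\<lambda>i. v $ i" "{..<n}"] assms
    by (simp add: eucl_norm_def)
qed

lemma eucl_norm_smult: "eucl_norm (a \<cdot>\<^sub>v v) = \<bar>a\<bar> * eucl_norm v"
proof -
  have "(a \<cdot>\<^sub>v v) \<bullet> (a \<cdot>\<^sub>v v) = a\<^sup>2 * (v \<bullet> v)"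
    by (simp add: scalar_prod_def sum_distrib_left power2_eq_square algebra_simps)
  then show ?thesis by (simp add: eucl_norm_sqrt real_sqrt_mult)
qed

lemma eucl_norm_append_power2: "(eucl_norm (u @\<^sub>v v))\<^sup>2 = (eucl_norm u)\<^sup>2 + (eucl_norm v)\<^sup>2"
  unfolding eucl_norm_power2
  by (rule scalar_prod_append[where ?n1.0="dim_vec u" and ?n2.0="dim_vec v"]) auto

lemma eucl_norm_le_append:
  "eucl_norm u \<le> eucl_norm (u @\<^sub>v v)" "eucl_norm v \<le> eucl_norm (u @\<^sub>v v)"
  by (rule power2_le_imp_le; simp add: eucl_norm_append_power2)+

lemma eucl_norm_append_le: "eucl_norm (u @\<^sub>v v) \<le> eucl_norm u + eucl_norm v"
  by (rule power2_le_imp_le) (simp_all add: eucl_norm_append_power2 power2_sum)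

text \<open>
  This transfers a Lipschitz bound for each partial derivative to the vector of all of them.
\<close>

lemma eucl_norm_componentwise_le:
  assumes "u \<in> carrier_vec n" "v \<in> carrier_vec n" "0 \<le> c"
    and "\<And>i. i < n \<Longrightarrow> \<bar>u $ i\<bar> \<le> c * \<bar>v $ i\<bar>"
  shows "eucl_norm u \<le> c * eucl_norm v"
proof -
  have "(\<Sum>i\<in>{0..<n}. u $ i * u $ i) \<le> (\<Sum>i\<in>{0..<n}. c\<^sup>2 * (v $ i * v $ i))"
  proof (rule sum_mono)
    fix i assume "i \<in> {0..<n}"
    then have "\<bar>u $ i\<bar>\<^sup>2 \<le> (c * \<bar>v $ i\<bar>)\<^sup>2" by (intro power_mono assms(4)) auto
    then show "u $ i * u $ i \<le> c\<^sup>2 * (v $ i * v $ i)"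
      by (simp add: power2_eq_square algebra_simps)
  qed
  then have "(eucl_norm u)\<^sup>2 \<le> (c * eucl_norm v)\<^sup>2"
    using assms(1,2) by (simp add: eucl_norm_power2 power_mult_distrib scalar_prod_def sum_distrib_left)
  then show ?thesis 
    by (rule power2_le_imp_le) (simp add: assms(3))
qed

section \<open>A quadratic form for which the saddle-point part is a rotation\<close>

text \<open>
  The form \<open>a\<^sup>2 + a b + b\<^sup>2\<close> is the norm form of the hexagonal lattice; the matrix with rows
  (1, 1) and (-1, 0) preserves it, being multiplication by a sixth root of unity.
\<close>

definition hex_energy :: "real vec \<Rightarrow> real vec \<Rightarrow> real" where
  "hex_energy u v = u \<bullet> u + u \<bullet> v + v \<bullet> v"

definition hex_norm :: "real vec \<Rightarrow> real vec \<Rightarrow> real" where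
  "hex_norm u v = sqrt (hex_energy u v)"

text \<open>
  Completing the square; the triangle inequality for the new norm is inherited through this
  linear change of variables.
\<close>

lemma hex_norm_conv_eucl_norm:
  assumes "u \<in> carrier_vec n" "v \<in> carrier_vec n"
  shows "hex_norm u v = eucl_norm ((u + (1/2) \<cdot>\<^sub>v v) @\<^sub>v ((sqrt 3 / 2) \<cdot>\<^sub>v v))"
proof -
  have "hex_energy u v = (u + (1/2) \<cdot>\<^sub>v v) \<bullet> (u + (1/2) \<cdot>\<^sub>v v) + ((sqrt 3 / 2) \<cdot>\<^sub>v v) \<bullet> ((sqrt 3 / 2) \<cdot>\<^sub>v v)"
    using assms comm_scalar_prod[OF assms]
    by (simp add: hex_energy_def scalar_prod_add_distrib[of _ n] add_scalar_prod_distrib[of _ n] field_simps)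
  also have "\<dots> = (eucl_norm ((u + (1/2) \<cdot>\<^sub>v v) @\<^sub>v ((sqrt 3 / 2) \<cdot>\<^sub>v v)))\<^sup>2"
    unfolding eucl_norm_append_power2 by (simp only: eucl_norm_power2)
  finally show ?thesis by (simp add: hex_norm_def)
qed

lemma hex_norm_nonneg:
  assumes "u \<in> carrier_vec n" "v \<in> carrier_vec n"
  shows "0 \<le> hex_norm u v"
  using hex_norm_conv_eucl_norm[OF assms] by simp

lemma hex_norm_triangle:
  assumes "u \<in> carrier_vec n" "v \<in> carrier_vec n" "u' \<in> carrier_vec n" "v' \<in> carrier_vec n"
  shows "hex_norm (u + u') (v + v') \<le> hex_norm u v + hex_norm u' v'"
proof -
  have "((u + u') + (1/2) \<cdot>\<^sub>v (v + v')) @\<^sub>v ((sqrt 3 / 2) \<cdot>\<^sub>v (v + v'))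
     = ((u + (1/2) \<cdot>\<^sub>v v) @\<^sub>v ((sqrt 3 / 2) \<cdot>\<^sub>v v)) + ((u' + (1/2) \<cdot>\<^sub>v v') @\<^sub>v ((sqrt 3 / 2) \<cdot>\<^sub>v v'))"
    using assms by (intro eq_vecI) (auto simp: field_simps)
  then show ?thesis
    using assms eucl_norm_triangle[of "(u + (1/2) \<cdot>\<^sub>v v) @\<^sub>v ((sqrt 3 / 2) \<cdot>\<^sub>v v)" "n + n" 
        "(u' + (1/2) \<cdot>\<^sub>v v') @\<^sub>v ((sqrt 3 / 2) \<cdot>\<^sub>v v')"]
    by (simp add: hex_norm_conv_eucl_norm[of _ n])
qed

lemma hex_energy_bounds:
  assumes "u \<in> carrier_vec n" "v \<in> carrier_vec n"
  shows "(u \<bullet> u + v \<bullet> v) / 2 \<le> hex_energy u v" "hex_energy u v \<le> 3 / 2 * (u \<bullet> u + v \<bullet> v)"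
proof -
  have "0 \<le> (u + v) \<bullet> (u + v)" "0 \<le> (u - v) \<bullet> (u - v)" by simp_all
  then have "0 \<le> u \<bullet> u + 2 * (u \<bullet> v) + v \<bullet> v" "0 \<le> u \<bullet> u - 2 * (u \<bullet> v) + v \<bullet> v"
    using assms comm_scalar_prod[OF assms]
    by (simp_all add: scalar_prod_add_distrib[of _ n] add_scalar_prod_distrib[of _ n]
       scalar_prod_minus_distrib[of _ n] minus_scalar_prod_distrib[of _ n])
  then show "(u \<bullet> u + v \<bullet> v) / 2 \<le> hex_energy u v" "hex_energy u v \<le> 3 / 2 * (u \<bullet> u + v \<bullet> v)"
    by (simp_all add: hex_energy_def)
qed

lemma hex_norm_le:
  assumes "u \<in> carrier_vec n" "v \<in> carrier_vec n"
  shows "hex_norm u v \<le> 2 * eucl_norm (u @\<^sub>v v)"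
proof -
  have "hex_energy u v \<le> 3 / 2 * (eucl_norm (u @\<^sub>v v))\<^sup>2"
    using hex_energy_bounds(2)[OF assms] by (simp add: eucl_norm_append_power2 eucl_norm_power2[of u] eucl_norm_power2[of v])
  also have "\<dots> \<le> (2 * eucl_norm (u @\<^sub>v v))\<^sup>2" by (simp add: power_mult_distrib)
  finally show ?thesis unfolding hex_norm_def by (rule real_le_lsqrt[rotated]) auto
qed

lemma eucl_norm_append_le_hex_norm:
  assumes "u \<in> carrier_vec n" "v \<in> carrier_vec n"
  shows "eucl_norm (u @\<^sub>v v) \<le> 2 * hex_norm u v"
proof -
  have "(eucl_norm (u @\<^sub>v v))\<^sup>2 \<le> 2 * hex_energy u v"
    using hex_energy_bounds(1)[OF assms] by (simp add: eucl_norm_append_power2 eucl_norm_power2[of u] eucl_norm_power2[of v])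
  moreover have "0 \<le> (u \<bullet> u + v \<bullet> v) / 2" by simp
  then have "0 \<le> hex_energy u v" using hex_energy_bounds(1)[OF assms] by (rule order_trans)
  ultimately have "(eucl_norm (u @\<^sub>v v))\<^sup>2 \<le> (2 * hex_norm u v)\<^sup>2"
    by (simp add: power_mult_distrib hex_norm_def)
  then show ?thesis
    by (rule power2_le_imp_le) (simp add: hex_norm_nonneg[OF assms])
qed

lemma hex_norm_left: "u \<in> carrier_vec n \<Longrightarrow> hex_norm u (0\<^sub>v n) = eucl_norm u"
  by (simp add: hex_norm_def hex_energy_def eucl_norm_sqrt)

text \<open>
  Expanding the energy of the new pair, the terms linear in K add up to minus the energy form
  weighted by K (the symmetric part of the rotation is half the identity), and the quadratic terms
  are the energy of (K u, K v) (the rotation preserves the form). The difference is the energy form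
  weighted by K - K K. As \<open>a\<^sup>2 + a b + b\<^sup>2 = 3/4 (a + b)\<^sup>2 + 1/4 (a - b)\<^sup>2\<close>, a lower bound
  for K - K K on the two vectors u + v and u - v is all that is needed.
\<close>

lemma hex_energy_step:
  assumes K: "K \<in> carrier_mat n n" "K\<^sup>T = K" and uv: "u \<in> carrier_vec n" "v \<in> carrier_vec n"
    and coer: "\<And>y. y \<in> {u + v, u - v} \<Longrightarrow> \<delta> * (y \<bullet> y) \<le> y \<bullet> (K *\<^sub>v y) - (K *\<^sub>v y) \<bullet> (K *\<^sub>v y)"
  shows "hex_energy (u - K *\<^sub>v u - K *\<^sub>v v) (v + K *\<^sub>v u) \<le> (1 - \<delta>) * hex_energy u v"
proof -
  define p q where "p = K *\<^sub>v u" and "q = K *\<^sub>v v"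
  have pq: "p \<in> carrier_vec n" "q \<in> carrier_vec n" using K uv by (auto simp: p_def q_def)
  have sym: "v \<bullet> p = u \<bullet> q"
    using transpose_vec_mult_scalar[OF K(1) uv(2,1)] comm_scalar_prod[OF pq(1) uv(2)]
      K(2) comm_scalar_prod[OF uv(1) pq(2)] transpose_vec_mult_scalar[OF K(1) uv(1,2)]
    by (simp add: p_def q_def)
  note exp = scalar_prod_add_distrib[of _ n] add_scalar_prod_distrib[of _ n]
       scalar_prod_minus_distrib[of _ n] minus_scalar_prod_distrib[of _ n]
  have comm: "q \<bullet> p = p \<bullet> q" "p \<bullet> u = u \<bullet> p" "q \<bullet> u = u \<bullet> q" "p \<bullet> v = v \<bullet> p" "q \<bullet> v = v \<bullet> q" "v \<bullet> u = u \<bullet> v"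
    using uv pq by (auto intro: comm_scalar_prod)
  have Kp: "K *\<^sub>v (u + v) = p + q" and Km: "K *\<^sub>v (u - v) = p - q"
    using K uv by (auto simp: p_def q_def mult_add_distrib_mat_vec[of _ n n] mult_minus_distrib_mat_vec[of _ n n])
  have "hex_energy (u - p - q) (v + p) = hex_energy u v - (u \<bullet> p + u \<bullet> q + v \<bullet> q) + hex_energy p q"
    using uv pq by (simp add: hex_energy_def exp comm sym)
  moreover have "\<delta> * (u \<bullet> u + 2 * (u \<bullet> v) + v \<bullet> v)
     \<le> (u \<bullet> p + 2 * (u \<bullet> q) + v \<bullet> q) - (p \<bullet> p + 2 * (p \<bullet> q) + q \<bullet> q)"
    using coer[of "u + v"] uv pq by (simp add: Kp exp comm sym algebra_simps)
  moreover have "\<delta> * (u \<bullet> u - 2 * (u \<bullet> v) + v \<bullet> v)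
     \<le> (u \<bullet> p - 2 * (u \<bullet> q) + v \<bullet> q) - (p \<bullet> p - 2 * (p \<bullet> q) + q \<bullet> q)"
    using coer[of "u - v"] uv pq by (simp add: Km exp comm sym algebra_simps)
  ultimately show ?thesis
    unfolding p_def[symmetric] q_def[symmetric] by (simp add: hex_energy_def algebra_simps)
qed

lemma hex_norm_step:
  assumes "K \<in> carrier_mat n n" "K\<^sup>T = K" "u \<in> carrier_vec n" "v \<in> carrier_vec n"
    and "\<And>y. y \<in> {u + v, u - v} \<Longrightarrow> \<delta> * (y \<bullet> y) \<le> y \<bullet> (K *\<^sub>v y) - (K *\<^sub>v y) \<bullet> (K *\<^sub>v y)"
    and "\<delta> \<le> 1"
  shows "hex_norm (u - K *\<^sub>v u - K *\<^sub>v v) (v + K *\<^sub>v u) \<le> (1 - \<delta> / 2) * hex_norm u v"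
proof -
  have *: "1 - \<delta> \<le> (1 - \<delta> / 2)\<^sup>2" by (simp add: power2_eq_square field_simps)
  have "hex_norm (u - K *\<^sub>v u - K *\<^sub>v v) (v + K *\<^sub>v u) \<le> sqrt ((1 - \<delta>) * hex_energy u v)"
    unfolding hex_norm_def using hex_energy_step[OF assms(1-5)] by simp
  also have "\<dots> = sqrt (1 - \<delta>) * hex_norm u v" by (simp add: real_sqrt_mult hex_norm_def)
  also have "\<dots> \<le> (1 - \<delta> / 2) * hex_norm u v"
    using assms * hex_norm_nonneg[OF assms(3,4)] by (intro mult_right_mono real_le_lsqrt) auto
  finally show ?thesis .
qed

section \<open>Coercivity on the mean-free vectors\<close>

lemma real_eigenvalue_bounds:
  assumes "spectrum (map_mat complex_of_real K) \<subseteq> complex_of_real ` {0..<1}"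
    and K: "K \<in> carrier_mat n n" and v: "v \<in> carrier_vec n" "v \<noteq> 0\<^sub>v n" "K *\<^sub>v v = r \<cdot>\<^sub>v v"
  shows "0 \<le> r" "r < 1"
proof -
  have "eigenvector (map_mat complex_of_real K) (map_vec complex_of_real v) (complex_of_real r)"
    using K v by (intro of_real_hom.eigenvector_hom[OF K]) (simp add: eigenvector_def)
  then have "eigenvalue (map_mat complex_of_real K) (complex_of_real r)"
    unfolding eigenvalue_def by blast
  then have "complex_of_real r \<in> complex_of_real ` {0..<1}"
    using assms(1) unfolding spectrum_def by blast
  then show "0 \<le> r" "r < 1" by auto
qed

text \<open>
  The unit sphere of a hyperplane, realised among the sequences that vanish from n on, is a closed
  subset of a product of compact intervals; the theorem of Tychonoff thus takes the place of that of
  Heine and Borel.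
\<close>

lemma compact_unit_sphere_slice:
  "compact {g :: nat \<Rightarrow> real. (\<forall>i\<ge>n. g i = 0) \<and> (\<Sum>i<n. (g i)\<^sup>2) = 1 \<and> (\<Sum>i<n. c i * g i) = 0}"
    (is "compact ?S")
proof -
  have box: "compact (PiE UNIV (\<lambda>_::nat. {-1..1::real}))"
  proof -
    have "compactin (product_topology (\<lambda>i::nat. euclidean :: real topology) UNIV) (PiE UNIV (\<lambda>_. {-1..1}))"
      by (simp add: compactin_PiE)
    then show ?thesis by (simp add: euclidean_product_topology)
  qed
  have "closed (\<Inter>i\<in>{n..}. {g :: nat \<Rightarrow> real. g i = 0})"
    by (intro closed_INT ballI closed_Collect_eq continuous_intros) simp
  then have c1: "closed {g :: nat \<Rightarrow> real. \<forall>i\<ge>n. g i = 0}"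
    by (rule back_subst[where P=closed]) auto
  have c2: "closed {g :: nat \<Rightarrow> real. (\<Sum>i<n. (g i)\<^sup>2) = 1}"
    by (intro closed_Collect_eq continuous_intros continuous_on_product_coordinates)
  have c3: "closed {g :: nat \<Rightarrow> real. (\<Sum>i<n. c i * g i) = 0}"
    by (intro closed_Collect_eq continuous_intros continuous_on_product_coordinates)
  have "closed ?S"
    by (rule back_subst[where P=closed, OF closed_Int[OF c1 closed_Int[OF c2 c3]]]) auto
  moreover have "?S \<subseteq> PiE UNIV (\<lambda>_::nat. {-1..1::real})"
  proof
    fix g assume g: "g \<in> ?S"
    have "\<bar>g i\<bar> \<le> 1" for i
    proof (cases "i < n")
      case True
      have "(g i)\<^sup>2 \<le> (\<Sum>i<n. (g i)\<^sup>2)" using True by (intro member_le_sum) auto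
      then show ?thesis using g by (simp add: abs_square_le_1)
    qed (use g in simp)
    then show "g \<in> PiE UNIV (\<lambda>_::nat. {-1..1::real})" by (auto simp: abs_le_iff minus_le_iff)
  qed
  ultimately show ?thesis using box compact_Int_closed[of "PiE UNIV (\<lambda>_::nat. {-1..1::real})" ?S]
    by (simp add: Int_absorb1)
qed

lemma quadratic_form_minimiser:
  assumes A: "A \<in> carrier_mat n n" and c: "c \<in> carrier_vec n"
    and y0: "y0 \<in> carrier_vec n" "c \<bullet> y0 = 0" "y0 \<noteq> (0\<^sub>v n :: real vec)"
  obtains u where "u \<in> carrier_vec n" "c \<bullet> u = 0" "u \<bullet> u = 1"
    "\<And>y. y \<in> carrier_vec n \<Longrightarrow> c \<bullet> y = 0 \<Longrightarrow> (u \<bullet> (A *\<^sub>v u)) * (y \<bullet> y) \<le> y \<bullet> (A *\<^sub>v y)"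
proof -
  define S where "S = {g :: nat \<Rightarrow> real. (\<forall>i\<ge>n. g i = 0) \<and> (\<Sum>i<n. (g i)\<^sup>2) = 1 \<and> (\<Sum>i<n. c $ i * g i) = 0}"
  define F where "F g = (\<Sum>i<n. g i * (\<Sum>j<n. A $$ (i, j) * g j))" for g :: "nat \<Rightarrow> real"
  have F: "F (\<lambda>i. if i < n then y $ i else 0) = y \<bullet> (A *\<^sub>v y)" if "y \<in> carrier_vec n" for y
    using that A by (auto simp: F_def scalar_prod_def lessThan_atLeast0 intro!: sum.cong)
  have F': "F g = vec n g \<bullet> (A *\<^sub>v vec n g)" for g
    using A by (auto simp: F_def scalar_prod_def lessThan_atLeast0 intro!: sum.cong)
  have normalise: "(\<lambda>i. if i < n then ((1 / eucl_norm y) \<cdot>\<^sub>v y) $ i else 0) \<in> S"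
    if y: "y \<in> carrier_vec n" "c \<bullet> y = 0" "y \<noteq> 0\<^sub>v n" for y
  proof -
    define h where "h = (1 / eucl_norm y) \<cdot>\<^sub>v y"
    have h: "h \<in> carrier_vec n" using y by (simp add: h_def)
    have "y \<bullet> y \<noteq> 0" using scalar_prod_self_eq_0 y by blast
    then have "eucl_norm y \<noteq> 0" using eucl_norm_power2[of y] by auto
    then have "h \<bullet> h = 1" "c \<bullet> h = 0"
      using y c by (simp_all add: h_def eucl_norm_power2[symmetric] eucl_norm_smult power2_eq_square)
    then show ?thesis using h c unfolding h_def[symmetric] S_def
      by (simp add: scalar_prod_def lessThan_atLeast0 power2_eq_square)
  qed
  have "compact S" unfolding S_def by (rule compact_unit_sphere_slice)
  moreover have "S \<noteq> {}" using normalise[OF y0] by blast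
  moreover have "continuous_on S F" unfolding F_def
    by (rule continuous_on_subset[OF _ subset_UNIV])
      (intro continuous_intros continuous_on_product_coordinates)
  ultimately obtain g where g: "g \<in> S" "\<And>h. h \<in> S \<Longrightarrow> F g \<le> F h"
    using continuous_attains_inf by metis
  show thesis
  proof (rule that[of "vec n g"])
    show "c \<bullet> vec n g = 0" "vec n g \<bullet> vec n g = 1"
      using g(1) c by (auto simp: S_def scalar_prod_def lessThan_atLeast0 power2_eq_square)
    fix y assume y: "y \<in> carrier_vec n" "c \<bullet> y = 0"
    show "vec n g \<bullet> (A *\<^sub>v vec n g) * (y \<bullet> y) \<le> y \<bullet> (A *\<^sub>v y)"
    proof (cases "y = 0\<^sub>v n")
      case True then show ?thesis using A by simp
    next
      case False
      define h where "h = (1 / eucl_norm y) \<cdot>\<^sub>v y"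
      have h: "h \<in> carrier_vec n" using y by (simp add: h_def)
      have "y \<bullet> y \<noteq> 0" using scalar_prod_self_eq_0 y False by blast
      then have pos: "eucl_norm y > 0" using eucl_norm_power2[of y] eucl_norm_nonneg[of y] by (metis less_eq_real_def zero_power2)
      have "F g \<le> h \<bullet> (A *\<^sub>v h)"
        using g(2)[OF normalise[OF y False]] unfolding h_def[symmetric] F[OF h] .
      also have "\<dots> = (y \<bullet> (A *\<^sub>v y)) / (y \<bullet> y)"
      proof -
        have "A *\<^sub>v h = (1 / eucl_norm y) \<cdot>\<^sub>v (A *\<^sub>v y)" unfolding h_def by (rule mult_mat_vec[OF A y(1)])
        moreover have "A *\<^sub>v y \<in> carrier_vec n" using A y by simp
        ultimately show ?thesis using y
          by (simp add: h_def eucl_norm_power2[symmetric] power2_eq_square)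
      qed
      finally show ?thesis using pos
        by (simp add: F'[symmetric] eucl_norm_power2[symmetric] field_simps)
    qed
  qed simp
qed

text \<open>
  First-order condition: with \<mu> the minimal value, the form of B - \<mu> is nonnegative on the
  hyperplane and vanishes at u. Moving from u in the direction of the residual h = B u - \<mu> u, which
  lies in the hyperplane because B preserves it, changes the form by \<open>2 s (h \<bullet> h)\<close> to first order
  in s, for either sign of s; hence h = 0.
\<close>

lemma minimiser_is_eigenvector:
  assumes B: "B \<in> carrier_mat n n" "B\<^sup>T = B" and c: "c \<in> carrier_vec n"
    and inv: "\<And>y. y \<in> carrier_vec n \<Longrightarrow> c \<bullet> y = 0 \<Longrightarrow> c \<bullet> (B *\<^sub>v y) = (0::real)"
    and u: "u \<in> carrier_vec n" "c \<bullet> u = 0" "u \<bullet> u = 1"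
    and min: "\<And>y. y \<in> carrier_vec n \<Longrightarrow> c \<bullet> y = 0 \<Longrightarrow> (u \<bullet> (B *\<^sub>v u)) * (y \<bullet> y) \<le> y \<bullet> (B *\<^sub>v y)"
  shows "B *\<^sub>v u = (u \<bullet> (B *\<^sub>v u)) \<cdot>\<^sub>v u"
proof -
  define \<mu> where "\<mu> = u \<bullet> (B *\<^sub>v u)"
  define h where "h = B *\<^sub>v u - \<mu> \<cdot>\<^sub>v u"
  define F where "F = h \<bullet> (B *\<^sub>v h) - \<mu> * (h \<bullet> h)"
  define a where "a = h \<bullet> h"
  have Bu: "B *\<^sub>v u \<in> carrier_vec n" using B u by simp
  have h: "h \<in> carrier_vec n" using Bu u by (simp add: h_def)
  have Bh: "B *\<^sub>v h \<in> carrier_vec n" using B h by simp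
  have ch: "c \<bullet> h = 0" using inv[OF u(1,2)] u c Bu by (simp add: h_def scalar_prod_minus_distrib[of _ n])
  have uBh: "u \<bullet> (B *\<^sub>v h) = h \<bullet> (B *\<^sub>v u)"
    using transpose_vec_mult_scalar[OF B(1) h u(1)] B(2) comm_scalar_prod[OF Bu h] by simp
  have a: "h \<bullet> (B *\<^sub>v u) - \<mu> * (h \<bullet> u) = a"
  proof -
    have "h \<bullet> (B *\<^sub>v u - \<mu> \<cdot>\<^sub>v u) = h \<bullet> (B *\<^sub>v u) - \<mu> * (h \<bullet> u)"
      using h u Bu by (simp add: scalar_prod_minus_distrib[of _ n])
    then show ?thesis unfolding h_def[symmetric] a_def by (rule sym)
  qed
  have uh: "u \<bullet> h = h \<bullet> u" using u h by (intro comm_scalar_prod) auto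
  have ineq: "0 \<le> 2 * s * a + s\<^sup>2 * F" for s
  proof -
    let ?y = "u + s \<cdot>\<^sub>v h"
    have By: "B *\<^sub>v ?y = B *\<^sub>v u + s \<cdot>\<^sub>v (B *\<^sub>v h)"
      using B u h by (simp add: mult_add_distrib_mat_vec[of _ n n] mult_mat_vec[of _ n n])
    have "\<mu> * (?y \<bullet> ?y) \<le> ?y \<bullet> (B *\<^sub>v ?y)"
      unfolding \<mu>_def using u h c ch by (intro min) (auto simp: scalar_prod_add_distrib[of _ n])
    then show ?thesis unfolding By using u h Bu Bh
      by (simp add: scalar_prod_add_distrib[of _ n] add_scalar_prod_distrib[of _ n] uBh uh F_def
          a[symmetric] \<mu>_def[symmetric] u(3) algebra_simps power2_eq_square)
  qed
  have "a = 0"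
  proof (rule ccontr)
    assume "a \<noteq> 0"
    then have apos: "a > 0" using scalar_prod_self_nonneg[of h] by (simp add: a_def less_le)
    \<comment> \<open>small enough that the second-order term F cannot outweigh the first-order term\<close>
    define s where "s = - a / (\<bar>F\<bar> + 1)"
    have s: "s < 0" using apos by (simp add: s_def divide_neg_pos)
    have "\<bar>s * F\<bar> = a * (\<bar>F\<bar> / (\<bar>F\<bar> + 1))" using apos by (simp add: s_def abs_mult)
    also have "\<dots> \<le> a * 1" using apos by (intro mult_left_mono) auto
    finally have "a \<le> 2 * a + s * F" by (simp add: abs_le_iff)
    then have "0 < 2 * a + s * F" using apos by linarith
    then have "s * (2 * a + s * F) < 0" using s by (simp add: mult_neg_pos)
    then show False using ineq[of s] by (simp add: algebra_simps power2_eq_square)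
  qed
  then have h0: "h = 0\<^sub>v n" using scalar_prod_self_eq_0[OF h] by (simp add: a_def)
  have "B *\<^sub>v u = h + \<mu> \<cdot>\<^sub>v u" using B(1) Bu u by (intro eq_vecI) (auto simp: h_def)
  then show ?thesis using u by (simp add: h0 \<mu>_def)
qed

lemma ones_vec_carrier [simp]: "ones_vec N \<in> carrier_vec N"
  by (simp add: ones_vec_def)

lemma ones_vec_dim [simp]: "dim_vec (ones_vec N) = N"
  by (simp add: ones_vec_def)

lemma ones_vec_index [simp]: "i < N \<Longrightarrow> ones_vec N $ i = 1"
  by (simp add: ones_vec_def)

text \<open>
  The minimum \<mu> of the form of B = K - K K on mean-free unit vectors is attained at an eigenvector
  u of B. If \<mu> were not positive, the roots a \<le> 0 and b \<ge> 1 of \<open>t\<^sup>2 - t + \<mu>\<close> would be real, and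
  (K - b) (K - a) u = 0. Because b is not an eigenvalue of K, this makes u an eigenvector for a; the
  spectrum leaves only a = 0, so u is constant and mean-free, hence zero. This route avoids
  diagonalising K.
\<close>

lemma consensus_gap:
  fixes K :: "real mat"
  assumes K: "K \<in> carrier_mat N N" "K\<^sup>T = K"
    and ker: "mat_kernel K = {c \<cdot>\<^sub>v ones_vec N | c. True}"
    and spec: "spectrum (map_mat complex_of_real K) \<subseteq> complex_of_real ` {0..<1}"
  obtains \<delta> where "0 < \<delta>" "\<delta> \<le> 1" "\<And>y. y \<in> carrier_vec N \<Longrightarrow> ones_vec N \<bullet> y = 0 \<Longrightarrow>
    \<delta> * (y \<bullet> y) \<le> y \<bullet> (K *\<^sub>v y) - (K *\<^sub>v y) \<bullet> (K *\<^sub>v y)"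
proof (cases "\<exists>y0. y0 \<in> carrier_vec N \<and> ones_vec N \<bullet> y0 = 0 \<and> y0 \<noteq> (0\<^sub>v N :: real vec)")
  case False
  \<comment> \<open>for N \<le> 1 zero is the only mean-free vector, and any constant will do\<close>
  have "1 * (y \<bullet> y) \<le> y \<bullet> (K *\<^sub>v y) - (K *\<^sub>v y) \<bullet> (K *\<^sub>v y)"
    if "y \<in> carrier_vec N" "ones_vec N \<bullet> y = 0" for y
  proof -
    have "y = 0\<^sub>v N" using False that by blast
    moreover have "K *\<^sub>v 0\<^sub>v N = 0\<^sub>v N" using K by (intro eq_vecI) auto
    ultimately show ?thesis by simp
  qed
  then show ?thesis using that[of 1] by simp
next
  case True
  then obtain y0 where y0: "y0 \<in> carrier_vec N" "ones_vec N \<bullet> y0 = 0" "y0 \<noteq> (0\<^sub>v N :: real vec)" by blast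
  define B where "B = K - K * K"
  have B: "B \<in> carrier_mat N N" "B\<^sup>T = B"
    using K by (auto simp: B_def transpose_minus[of _ N N] transpose_mult[of _ N N _ N])
  have Bv: "B *\<^sub>v y = K *\<^sub>v y - K *\<^sub>v (K *\<^sub>v y)" if "y \<in> carrier_vec N" for y
    using K that by (simp add: B_def minus_mult_distrib_mat_vec[of _ N N] assoc_mult_mat_vec[of _ N N _ N])
  have Kone: "K *\<^sub>v ones_vec N = 0\<^sub>v N"
  proof -
    have "1 \<cdot>\<^sub>v ones_vec N \<in> mat_kernel K" unfolding ker by blast
    then show ?thesis using K by (simp add: mat_kernel_def)
  qed
  have oneK: "ones_vec N \<bullet> (K *\<^sub>v y) = 0" if "y \<in> carrier_vec N" for y
    using transpose_vec_mult_scalar[OF K(1) that ones_vec_carrier] that by (simp add: K(2) Kone)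
  have form: "y \<bullet> (B *\<^sub>v y) = y \<bullet> (K *\<^sub>v y) - (K *\<^sub>v y) \<bullet> (K *\<^sub>v y)" if y: "y \<in> carrier_vec N" for y
  proof -
    have Ky: "K *\<^sub>v y \<in> carrier_vec N" using K y by simp
    have "y \<bullet> (K *\<^sub>v (K *\<^sub>v y)) = (K *\<^sub>v y) \<bullet> (K *\<^sub>v y)"
      using transpose_vec_mult_scalar[OF K(1) Ky y] by (simp add: K(2))
    then show ?thesis using y Ky K by (simp add: Bv scalar_prod_minus_distrib[of _ N])
  qed
  obtain u where u: "u \<in> carrier_vec N" "ones_vec N \<bullet> u = 0" "u \<bullet> u = 1"
    and min: "\<And>y. y \<in> carrier_vec N \<Longrightarrow> ones_vec N \<bullet> y = 0 \<Longrightarrow> (u \<bullet> (B *\<^sub>v u)) * (y \<bullet> y) \<le> y \<bullet> (B *\<^sub>v y)"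
    using quadratic_form_minimiser[OF B(1) ones_vec_carrier y0] by metis
  define \<mu> where "\<mu> = u \<bullet> (B *\<^sub>v u)"
  have inv: "ones_vec N \<bullet> (B *\<^sub>v y) = 0" if "y \<in> carrier_vec N" for y
    using K that oneK[OF that] oneK[of "K *\<^sub>v y"] by (simp add: Bv scalar_prod_minus_distrib[of _ N])
  have eig: "B *\<^sub>v u = \<mu> \<cdot>\<^sub>v u"
    unfolding \<mu>_def using inv by (intro minimiser_is_eigenvector[OF B ones_vec_carrier _ u min]) auto
  have unz: "u \<noteq> 0\<^sub>v N" using u(3) by auto
  have "\<mu> > 0"
  proof (rule ccontr)
    assume "\<not> \<mu> > 0"
    define d where "d = sqrt (1 - 4 * \<mu>)"
    have d: "d \<ge> 1" "d * d = 1 - 4 * \<mu>" using \<open>\<not> \<mu> > 0\<close> by (auto simp: d_def)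
    define a b where "a = (1 - d) / 2" and "b = (1 + d) / 2"
    have ab: "a + b = 1" "a * b = \<mu>" "a \<le> 0" "b \<ge> 1"
      using d by (auto simp: a_def b_def field_simps)
    define y where "y = K *\<^sub>v u - a \<cdot>\<^sub>v u"
    have Ku: "K *\<^sub>v u \<in> carrier_vec N" using K u by simp
    have y: "y \<in> carrier_vec N" using Ku u by (simp add: y_def)
    have KKu: "K *\<^sub>v (K *\<^sub>v u) = K *\<^sub>v u - \<mu> \<cdot>\<^sub>v u"
    proof -
      have "K *\<^sub>v (K *\<^sub>v u) \<in> carrier_vec N" using K Ku by simp
      then have "K *\<^sub>v (K *\<^sub>v u) = K *\<^sub>v u - (K *\<^sub>v u - K *\<^sub>v (K *\<^sub>v u))"
        using K(1) Ku by (intro eq_vecI) (auto simp del: index_mult_mat_vec)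
      then show ?thesis using eig Bv[OF u(1)] by simp
    qed
    have "K *\<^sub>v y = K *\<^sub>v u - \<mu> \<cdot>\<^sub>v u - a \<cdot>\<^sub>v (K *\<^sub>v u)"
      using K u Ku by (simp add: y_def mult_minus_distrib_mat_vec[of _ N N] mult_mat_vec[of _ N N] KKu)
    also have "\<dots> = b \<cdot>\<^sub>v y"
    proof -
      have b: "b = 1 - a" using ab(1) by simp
      have m: "\<mu> = a * (1 - a)" using ab(2) b by simp
      show ?thesis unfolding b m
        using K(1) Ku u by (intro eq_vecI) (auto simp: y_def algebra_simps simp del: index_mult_mat_vec)
    qed
    finally have "K *\<^sub>v y = b \<cdot>\<^sub>v y" .
    then have "y = 0\<^sub>v N" using real_eigenvalue_bounds(2)[OF spec K(1) y] ab by force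
    moreover have "K *\<^sub>v u = y + a \<cdot>\<^sub>v u"
      using K(1) Ku u by (intro eq_vecI) (auto simp: y_def simp del: index_mult_mat_vec)
    ultimately have Kua: "K *\<^sub>v u = a \<cdot>\<^sub>v u" using u by simp
    then have "a = 0" using real_eigenvalue_bounds(1)[OF spec K(1) u(1) unz] ab by force
    moreover have "0 \<cdot>\<^sub>v u = 0\<^sub>v N" using u by (intro eq_vecI) auto
    ultimately have "u \<in> mat_kernel K" using Kua u K by (simp add: mat_kernel_def)
    then obtain c where c: "u = c \<cdot>\<^sub>v ones_vec N" unfolding ker by blast
    have "u \<bullet> u = c * (ones_vec N \<bullet> u)" by (subst (1) c) (use u in simp)
    then show False using u by simp
  qed
  moreover have "min \<mu> 1 * (y \<bullet> y) \<le> y \<bullet> (K *\<^sub>v y) - (K *\<^sub>v y) \<bullet> (K *\<^sub>v y)"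
    if "y \<in> carrier_vec N" "ones_vec N \<bullet> y = 0" for y
  proof -
    have "min \<mu> 1 * (y \<bullet> y) \<le> \<mu> * (y \<bullet> y)" by (intro mult_right_mono) auto
    also have "\<dots> \<le> y \<bullet> (B *\<^sub>v y)" unfolding \<mu>_def by (rule min[OF that])
    finally show ?thesis using form that by simp
  qed
  ultimately show ?thesis using that[of "min \<mu> 1"] by simp
qed

section \<open>Mean and mean-free part; the target set\<close>

definition mean_free :: "nat \<Rightarrow> real vec \<Rightarrow> real vec" where
  "mean_free N v = v - avg_comp N v \<cdot>\<^sub>v ones_vec N"

lemma dim_mean_free [simp]: "dim_vec (mean_free N v) = N"
  by (simp add: mean_free_def)

lemma mean_free_carrier [simp]: "v \<in> carrier_vec N \<Longrightarrow> mean_free N v \<in> carrier_vec N"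
  by (simp add: mean_free_def)

lemma mean_free_decomp: "v \<in> carrier_vec N \<Longrightarrow> v = avg_comp N v \<cdot>\<^sub>v ones_vec N + mean_free N v"
  by (intro eq_vecI) (auto simp: mean_free_def)

lemma ones_scalar_prod: "v \<in> carrier_vec N \<Longrightarrow> ones_vec N \<bullet> v = (\<Sum>i<N. v $ i)"
  by (simp add: scalar_prod_def lessThan_atLeast0)

lemma avg_comp_sum: "v \<in> carrier_vec N \<Longrightarrow> avg_comp N v = (\<Sum>i<N. v $ i) / real N"
  by (simp add: avg_comp_def ones_scalar_prod)

lemma ones_scalar_prod_ones: "ones_vec N \<bullet> ones_vec N = real N"
  by (simp add: ones_scalar_prod)

lemma avg_comp_add: "u \<in> carrier_vec N \<Longrightarrow> v \<in> carrier_vec N \<Longrightarrow> avg_comp N (u + v) = avg_comp N u + avg_comp N v"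
  by (simp add: avg_comp_def scalar_prod_add_distrib[of _ N] add_divide_distrib)

lemma avg_comp_minus: "u \<in> carrier_vec N \<Longrightarrow> v \<in> carrier_vec N \<Longrightarrow> avg_comp N (u - v) = avg_comp N u - avg_comp N v"
  by (simp add: avg_comp_def scalar_prod_minus_distrib[of _ N] diff_divide_distrib)

lemma avg_comp_smult: "v \<in> carrier_vec N \<Longrightarrow> avg_comp N (a \<cdot>\<^sub>v v) = a * avg_comp N v"
  by (simp add: avg_comp_def)

lemma mean_free_add:
  "u \<in> carrier_vec N \<Longrightarrow> v \<in> carrier_vec N \<Longrightarrow> mean_free N (u + v) = mean_free N u + mean_free N v"
  by (intro eq_vecI) (auto simp: mean_free_def avg_comp_add algebra_simps)

lemma mean_free_minus:
  "u \<in> carrier_vec N \<Longrightarrow> v \<in> carrier_vec N \<Longrightarrow> mean_free N (u - v) = mean_free N u - mean_free N v"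
  by (intro eq_vecI) (auto simp: mean_free_def avg_comp_minus algebra_simps)

lemma mean_free_smult:
  "v \<in> carrier_vec N \<Longrightarrow> mean_free N (a \<cdot>\<^sub>v v) = a \<cdot>\<^sub>v mean_free N v"
  by (intro eq_vecI) (auto simp: mean_free_def avg_comp_smult algebra_simps)

lemma mean_free_id: "v \<in> carrier_vec N \<Longrightarrow> ones_vec N \<bullet> v = 0 \<Longrightarrow> mean_free N v = v"
  by (intro eq_vecI) (auto simp: mean_free_def avg_comp_def)

lemma avg_comp_0: "ones_vec N \<bullet> v = 0 \<Longrightarrow> avg_comp N v = 0"
  by (simp add: avg_comp_def)

text \<open>
  Pythagoras for the splitting into a constant and a mean-free vector.
\<close>

lemma eucl_norm_ones_plus_orthogonal:
  assumes "h \<in> carrier_vec N" "ones_vec N \<bullet> h = 0"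
  shows "(eucl_norm (c \<cdot>\<^sub>v ones_vec N + h))\<^sup>2 = real N * c\<^sup>2 + (eucl_norm h)\<^sup>2"
proof -
  have "h \<bullet> ones_vec N = 0" using assms comm_scalar_prod[of h N "ones_vec N"] by simp
  then show ?thesis unfolding eucl_norm_power2 using assms
    by (simp add: scalar_prod_add_distrib[of _ N] add_scalar_prod_distrib[of _ N]
        ones_scalar_prod_ones power2_eq_square)
qed

locale consensus =
  fixes N :: nat and K S :: "real mat"
  assumes N: "N \<ge> 1"
    and K: "K \<in> carrier_mat N N" and K_sym: "K\<^sup>T = K"
    and kerK: "mat_kernel K = {c \<cdot>\<^sub>v ones_vec N | c. True}"
    and specK: "spectrum (map_mat complex_of_real K) \<subseteq> complex_of_real ` {0..<1}"
    and dispS: "dispersion_basis N S"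
begin

lemma ones_mean_free [simp]: "v \<in> carrier_vec N \<Longrightarrow> ones_vec N \<bullet> mean_free N v = 0"
  using N by (simp add: mean_free_def scalar_prod_minus_distrib[of _ N] ones_scalar_prod_ones avg_comp_def)

lemma avg_comp_ones [simp]: "avg_comp N (ones_vec N) = 1"
  using N by (simp add: avg_comp_def ones_scalar_prod_ones)

lemma eucl_norm_decomp:
  assumes "v \<in> carrier_vec N"
  shows "(eucl_norm v)\<^sup>2 = real N * (avg_comp N v)\<^sup>2 + (eucl_norm (mean_free N v))\<^sup>2"
  using eucl_norm_ones_plus_orthogonal[of "mean_free N v" N "avg_comp N v"] assms
  by (simp flip: mean_free_decomp)

lemma eucl_norm_mean_free_le: "v \<in> carrier_vec N \<Longrightarrow> eucl_norm (mean_free N v) \<le> eucl_norm v"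
  by (rule power2_le_imp_le) (simp_all add: eucl_norm_decomp)

lemma abs_avg_comp_le:
  assumes "v \<in> carrier_vec N"
  shows "\<bar>avg_comp N v\<bar> \<le> eucl_norm v"
proof (rule power2_le_imp_le)
  have "1 * (avg_comp N v)\<^sup>2 \<le> real N * (avg_comp N v)\<^sup>2" using N by (intro mult_right_mono) auto
  then show "\<bar>avg_comp N v\<bar>\<^sup>2 \<le> (eucl_norm v)\<^sup>2"
    unfolding power2_abs eucl_norm_decomp[OF assms]
    using zero_le_power2[of "eucl_norm (mean_free N v)"] by linarith
qed simp

lemma eucl_norm_le_avg_mean_free:
  assumes "v \<in> carrier_vec N"
  shows "eucl_norm v \<le> real N * \<bar>avg_comp N v\<bar> + eucl_norm (mean_free N v)"
proof (rule power2_le_imp_le)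
  have "real N * \<bar>avg_comp N v\<bar>\<^sup>2 \<le> real N * (real N * \<bar>avg_comp N v\<bar>\<^sup>2)"
    using N mult_right_mono[of 1 "real N" "\<bar>avg_comp N v\<bar>\<^sup>2"] by (intro mult_left_mono) auto
  then have "real N * (avg_comp N v)\<^sup>2 \<le> (real N * \<bar>avg_comp N v\<bar>)\<^sup>2"
    by (simp add: power2_eq_square mult_ac)
  then show "(eucl_norm v)\<^sup>2 \<le> (real N * \<bar>avg_comp N v\<bar> + eucl_norm (mean_free N v))\<^sup>2"
    unfolding eucl_norm_decomp[OF assms] power2_sum by (simp add: add_increasing2)
qed simp

lemma K_ones: "K *\<^sub>v ones_vec N = 0\<^sub>v N"
proof -
  have "1 \<cdot>\<^sub>v ones_vec N \<in> mat_kernel K" unfolding kerK by blast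
  then show ?thesis using K by (simp add: mat_kernel_def)
qed

lemma ones_K: "v \<in> carrier_vec N \<Longrightarrow> ones_vec N \<bullet> (K *\<^sub>v v) = 0"
  using transpose_vec_mult_scalar[OF K _ ones_vec_carrier, of v] by (simp add: K_sym K_ones)

lemma K_mult_carrier [simp]: "v \<in> carrier_vec N \<Longrightarrow> K *\<^sub>v v \<in> carrier_vec N"
  using K by simp

lemma K_mean_free: "v \<in> carrier_vec N \<Longrightarrow> K *\<^sub>v mean_free N v = K *\<^sub>v v"
  using K by (simp add: mean_free_def mult_minus_distrib_mat_vec[of _ N N] mult_mat_vec[of _ N N] K_ones)
    (intro eq_vecI; simp)

lemma mean_free_K: "v \<in> carrier_vec N \<Longrightarrow> mean_free N (K *\<^sub>v v) = K *\<^sub>v v"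
  by (rule mean_free_id) (simp_all add: ones_K)

lemma S_carrier: "S \<in> carrier_mat N (N - 1)" and ST_carrier: "S\<^sup>T \<in> carrier_mat (N - 1) N"
  and ST_ones: "S\<^sup>T *\<^sub>v ones_vec N = 0\<^sub>v (N - 1)" and STS: "S\<^sup>T * S = 1\<^sub>m (N - 1)"
  using dispS by (auto simp: dispersion_basis_def)

text \<open>
  Adding the normalised constant column to S yields a square matrix with orthonormal columns, whose
  rows are then orthonormal as well. This says that S times its transpose is the projection onto the
  mean-free vectors.
\<close>

lemma dispersion_basis_rows_orthonormal:
  assumes "i < N" "l < N"
  shows "(\<Sum>j<N - 1. S $$ (i, j) * S $$ (l, j)) = (if i = l then 1 else 0) - 1 / real N"
proof -
  obtain M where M: "N = Suc M" using N by (cases N) auto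
  define A where "A = mat N N (\<lambda>(i, j). if j < M then S $$ (i, j) else 1 / sqrt (real N))"
  have A: "A \<in> carrier_mat N N" by (simp add: A_def)
  have S: "S \<in> carrier_mat N M" using S_carrier M by simp
  have cols: "(\<Sum>k<N. S $$ (k, a) * S $$ (k, b)) = (if a = b then 1 else 0)" if "a < M" "b < M" for a b
  proof -
    have "(S\<^sup>T * S) $$ (a, b) = (1\<^sub>m M) $$ (a, b)" using STS M by simp
    then show ?thesis using that S by (simp add: scalar_prod_def lessThan_atLeast0)
  qed
  have colsum: "(\<Sum>k<N. S $$ (k, a)) = 0" if "a < M" for a
  proof -
    have "(S\<^sup>T *\<^sub>v ones_vec N) $ a = (0\<^sub>v M) $ a" using ST_ones M by simp
    then show ?thesis using that S by (simp add: scalar_prod_def lessThan_atLeast0)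
  qed
  have "A\<^sup>T * A = 1\<^sub>m N"
  proof (rule eq_matI)
    fix a b assume "a < dim_row (1\<^sub>m N)" "b < dim_col (1\<^sub>m N)"
    then have ab: "a < N" "b < N" by auto
    have "(A\<^sup>T * A) $$ (a, b) = (\<Sum>k<N. A $$ (k, a) * A $$ (k, b))"
      using ab A by (simp add: scalar_prod_def lessThan_atLeast0)
    also have "\<dots> = (if a = b then 1 else 0)"
    proof (cases "a < M"; cases "b < M")
      assume "a < M" "b < M"
      then show ?thesis using ab cols by (simp add: A_def)
    next
      assume "a < M" "\<not> b < M"
      then show ?thesis using ab colsum[of a] by (simp add: A_def sum_divide_distrib[symmetric])
    next
      assume "\<not> a < M" "b < M"
      then show ?thesis using ab colsum[of b] by (simp add: A_def sum_divide_distrib[symmetric])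
    next
      assume "\<not> a < M" "\<not> b < M"
      then have "a = b" using ab M by simp
      then show ?thesis using ab \<open>\<not> a < M\<close> N by (simp add: A_def)
    qed
    finally show "(A\<^sup>T * A) $$ (a, b) = (1\<^sub>m N) $$ (a, b)" using ab by simp
  qed (use A in auto)
  then have "A * A\<^sup>T = 1\<^sub>m N" using mat_mult_left_right_inverse[of "A\<^sup>T" N A] A by simp
  then have "(A * A\<^sup>T) $$ (i, l) = (1\<^sub>m N) $$ (i, l)" by simp
  then have "(\<Sum>j<N. A $$ (i, j) * A $$ (l, j)) = (if i = l then 1 else 0)"
    using assms A by (simp add: scalar_prod_def lessThan_atLeast0)
  moreover have "(\<Sum>j<N. A $$ (i, j) * A $$ (l, j)) = (\<Sum>j<M. S $$ (i, j) * S $$ (l, j)) + 1 / real N"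
    unfolding M using assms by (simp add: A_def M)
  ultimately show ?thesis using M by simp
qed

lemma S_ST_mult: 
  assumes v: "v \<in> carrier_vec N"
  shows "S *\<^sub>v (S\<^sup>T *\<^sub>v v) = mean_free N v"
proof (rule eq_vecI)
  fix i assume "i < dim_vec (mean_free N v)"
  then have i: "i < N" by simp
  have "(S *\<^sub>v (S\<^sup>T *\<^sub>v v)) $ i = (\<Sum>j<N - 1. S $$ (i, j) * (\<Sum>l<N. S $$ (l, j) * v $ l))"
    using i v S_carrier by (simp add: scalar_prod_def lessThan_atLeast0)
  also have "\<dots> = (\<Sum>l<N. (\<Sum>j<N - 1. S $$ (i, j) * S $$ (l, j)) * v $ l)"
    by (simp add: sum_distrib_left sum_distrib_right mult.assoc) (rule sum.swap)
  also have "\<dots> = (\<Sum>l<N. ((if i = l then 1 else 0) - 1 / real N) * v $ l)"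
  proof (rule sum.cong[OF refl])
    fix l assume "l \<in> {..<N}"
    then have l: "l < N" by simp
    show "(\<Sum>j<N - 1. S $$ (i, j) * S $$ (l, j)) * v $ l = ((if i = l then 1 else 0) - 1 / real N) * v $ l"
      unfolding dispersion_basis_rows_orthonormal[OF i l] ..
  qed
  also have "\<dots> = v $ i - avg_comp N v"
  proof -
    have "(if i = l then 1 else 0) * v $ l = (if i = l then v $ l else 0)" for l by simp
    then show ?thesis
      using i v by (simp add: left_diff_distrib sum_subtractf avg_comp_sum sum_divide_distrib)
  qed
  finally show "(S *\<^sub>v (S\<^sup>T *\<^sub>v v)) $ i = mean_free N v $ i" using i v by (simp add: mean_free_def)
qed (use v S_carrier in \<open>simp add: mean_free_def\<close>)

text \<open>
  Measuring the mean-free part in the coordinates given by S does not change its norm. This allows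
  the whole analysis to use mean-free vectors of dimension N.
\<close>

lemma eucl_norm_disp_comp:
  assumes v: "v \<in> carrier_vec N"
  shows "eucl_norm (disp_comp S v) = eucl_norm (mean_free N v)"
proof -
  have Sv: "S\<^sup>T *\<^sub>v v \<in> carrier_vec (N - 1)" using ST_carrier v by simp
  have "(S\<^sup>T *\<^sub>v v) \<bullet> (S\<^sup>T *\<^sub>v v) = v \<bullet> mean_free N v"
    using transpose_vec_mult_scalar[OF S_carrier Sv v] S_ST_mult[OF v] by simp
  also have "\<dots> = mean_free N v \<bullet> mean_free N v"
  proof -
    have "(avg_comp N v \<cdot>\<^sub>v ones_vec N + mean_free N v) \<bullet> mean_free N v = mean_free N v \<bullet> mean_free N v"
      using v by (simp add: add_scalar_prod_distrib[of _ N] smult_scalar_prod_distrib[of _ N])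
    then show ?thesis using mean_free_decomp[OF v] by simp
  qed
  finally show ?thesis by (simp add: eucl_norm_sqrt disp_comp_def)
qed

text \<open>
  A kernel vector v of the compressed matrix gives K S v = 0, so S v is constant; but the range of S
  is mean-free and S is injective, whence v = 0.
\<close>

lemma disp_laplacian_inverse:
  obtains Q where "mat_inverse (S\<^sup>T * K * S) = Some Q" "Q \<in> carrier_mat (N - 1) (N - 1)"
    "(S\<^sup>T * K * S) * Q = 1\<^sub>m (N - 1)"
proof -
  let ?P = "S\<^sup>T * K * S"
  have P: "?P \<in> carrier_mat (N - 1) (N - 1)" using S_carrier K by simp
  have "det ?P \<noteq> 0"
  proof
    assume "det ?P = 0"
    then obtain v where v: "v \<in> carrier_vec (N - 1)" "v \<noteq> 0\<^sub>v (N - 1)" "?P *\<^sub>v v = 0\<^sub>v (N - 1)"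
      using det_0_iff_vec_prod_zero_field[OF P] by blast
    have Sv: "S *\<^sub>v v \<in> carrier_vec N" using S_carrier v by simp
    have "?P *\<^sub>v v = S\<^sup>T *\<^sub>v (K *\<^sub>v (S *\<^sub>v v))"
      using S_carrier K v Sv by (simp add: assoc_mult_mat_vec[of _ "N - 1" N _ "N - 1"] assoc_mult_mat_vec[of _ "N - 1" N _ N])
    then have "S\<^sup>T *\<^sub>v (K *\<^sub>v (S *\<^sub>v v)) = 0\<^sub>v (N - 1)" using v(3) by simp
    moreover have "S *\<^sub>v 0\<^sub>v (N - 1) = 0\<^sub>v N" using S_carrier by (intro eq_vecI) auto
    ultimately have "S *\<^sub>v (S\<^sup>T *\<^sub>v (K *\<^sub>v (S *\<^sub>v v))) = 0\<^sub>v N" by (simp only:)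
    then have "K *\<^sub>v (S *\<^sub>v v) = 0\<^sub>v N"
      using S_ST_mult[of "K *\<^sub>v (S *\<^sub>v v)"] mean_free_K[OF Sv] Sv by simp
    then have "S *\<^sub>v v \<in> mat_kernel K" using Sv K by (simp add: mat_kernel_def)
    then obtain c where "S *\<^sub>v v = c \<cdot>\<^sub>v ones_vec N" unfolding kerK by blast
    then have "S\<^sup>T *\<^sub>v (S *\<^sub>v v) = c \<cdot>\<^sub>v (S\<^sup>T *\<^sub>v ones_vec N)"
      using mult_mat_vec[OF ST_carrier ones_vec_carrier] by simp
    moreover have "c \<cdot>\<^sub>v 0\<^sub>v (N - 1) = 0\<^sub>v (N - 1)" by (intro eq_vecI) auto
    ultimately have "(S\<^sup>T * S) *\<^sub>v v = 0\<^sub>v (N - 1)"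
      using ST_ones assoc_mult_mat_vec[OF ST_carrier S_carrier v(1)] by simp
    then show False using v STS by simp
  qed
  then have "?P \<in> Units (ring_mat TYPE(real) (N - 1) ())"
    by (rule det_non_zero_imp_unit[OF P])
  then obtain Q where "mat_inverse ?P = Some Q"
    using mat_inverse(1)[OF P, of "()"] by (cases "mat_inverse ?P") blast+
  then show ?thesis using that mat_inverse(2)[OF P] by blast
qed

definition dual_offset :: "(nat \<Rightarrow> real \<Rightarrow> real) \<Rightarrow> real \<Rightarrow> real \<Rightarrow> real vec" where
  "dual_offset f \<gamma> \<theta> = (- \<gamma>) \<cdot>\<^sub>v (S * the (mat_inverse (S\<^sup>T * K * S)) * S\<^sup>T
      *\<^sub>v grad_vec f (\<theta> \<cdot>\<^sub>v ones_vec N))"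

text \<open>
  With r the inverse of \<open>S\<^sup>T K S\<close> applied to \<open>S\<^sup>T\<close> g, the vector K S r is mean-free and has the same
  coordinates with respect to S as g; as S times its transpose is the mean-free projection, K S r is
  the mean-free part of g.
\<close>

lemma dual_offset:
  shows dual_offset_carrier [simp]: "dual_offset f \<gamma> \<theta> \<in> carrier_vec N"
    and ones_dual_offset: "ones_vec N \<bullet> dual_offset f \<gamma> \<theta> = 0"
    and K_dual_offset: "K *\<^sub>v dual_offset f \<gamma> \<theta> = (- \<gamma>) \<cdot>\<^sub>v mean_free N (grad_vec f (\<theta> \<cdot>\<^sub>v ones_vec N))"
proof -
  let ?g = "grad_vec f (\<theta> \<cdot>\<^sub>v ones_vec N)"
  have g: "?g \<in> carrier_vec N" by (simp add: grad_vec_def)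
  obtain Q where Q: "mat_inverse (S\<^sup>T * K * S) = Some Q" "Q \<in> carrier_mat (N - 1) (N - 1)"
    "(S\<^sup>T * K * S) * Q = 1\<^sub>m (N - 1)" by (rule disp_laplacian_inverse)
  define r where "r = Q *\<^sub>v (S\<^sup>T *\<^sub>v ?g)"
  have Sg: "S\<^sup>T *\<^sub>v ?g \<in> carrier_vec (N - 1)" using ST_carrier g by simp
  have r: "r \<in> carrier_vec (N - 1)" using Q Sg by (simp add: r_def)
  have Sr: "S *\<^sub>v r \<in> carrier_vec N" using S_carrier r by simp
  have off: "dual_offset f \<gamma> \<theta> = (- \<gamma>) \<cdot>\<^sub>v (S *\<^sub>v r)"
    using Q(1,2) S_carrier g Sg
    by (simp add: dual_offset_def r_def assoc_mult_mat_vec[of _ N "N - 1" _ N] assoc_mult_mat_vec[of _ N "N - 1" _ "N - 1"])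
  show "dual_offset f \<gamma> \<theta> \<in> carrier_vec N" using off Sr by simp
  show "ones_vec N \<bullet> dual_offset f \<gamma> \<theta> = 0"
    using transpose_vec_mult_scalar[OF S_carrier r ones_vec_carrier] ST_ones r Sr
    by (simp add: off scalar_prod_smult_distrib[of _ N])
  have "S\<^sup>T *\<^sub>v (K *\<^sub>v (S *\<^sub>v r)) = (S\<^sup>T * K * S) *\<^sub>v r"
    using S_carrier K r Sr by (simp add: assoc_mult_mat_vec[of _ "N - 1" N _ "N - 1"] assoc_mult_mat_vec[of _ "N - 1" N _ N])
  also have "\<dots> = (S\<^sup>T * K * S * Q) *\<^sub>v (S\<^sup>T *\<^sub>v ?g)"
    unfolding r_def using S_carrier K Q(2) Sg
    by (intro assoc_mult_mat_vec[symmetric]) auto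
  also have "\<dots> = S\<^sup>T *\<^sub>v ?g" using Q(3) Sg by simp
  finally have "S *\<^sub>v (S\<^sup>T *\<^sub>v (K *\<^sub>v (S *\<^sub>v r))) = mean_free N ?g" using S_ST_mult[OF g] by simp
  then have "K *\<^sub>v (S *\<^sub>v r) = mean_free N ?g"
    using S_ST_mult[of "K *\<^sub>v (S *\<^sub>v r)"] mean_free_K[OF Sr] Sr by simp
  then show "K *\<^sub>v dual_offset f \<gamma> \<theta> = (- \<gamma>) \<cdot>\<^sub>v mean_free N ?g"
    using off mult_mat_vec[OF K Sr] by simp
qed

text \<open>
  The only freedom in the target set is the mean of its second component, and by Pythagoras the
  infimum is attained where this mean agrees with that of z.
\<close>

lemma dist_to_target_set:
  assumes opt: "\<And>\<eta>. (\<Sum>i<N. deriv (f i) \<eta>) = 0 \<longleftrightarrow> \<eta> = \<theta>"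
    and x: "x \<in> carrier_vec N" and z: "z \<in> carrier_vec N"
  shows "dist_to_set (x @\<^sub>v z) (target_set N K f S \<gamma>)
    = eucl_norm ((x - \<theta> \<cdot>\<^sub>v ones_vec N) @\<^sub>v (mean_free N z - dual_offset f \<gamma> \<theta>))"
proof -
  let ?z = "dual_offset f \<gamma> \<theta>"
  let ?d = "eucl_norm ((x - \<theta> \<cdot>\<^sub>v ones_vec N) @\<^sub>v (mean_free N z - ?z))"
  let ?p = "\<lambda>c. (\<theta> \<cdot>\<^sub>v ones_vec N) @\<^sub>v (?z + c \<cdot>\<^sub>v ones_vec N)"
  have T: "target_set N K f S \<gamma> = range ?p"
    by (auto simp: target_set_def dual_offset_def opt)
  have h: "mean_free N z - ?z \<in> carrier_vec N" "ones_vec N \<bullet> (mean_free N z - ?z) = 0"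
    using z by (simp_all add: scalar_prod_minus_distrib[of _ N] ones_dual_offset)
  have dist: "(eucl_norm ((x @\<^sub>v z) - ?p c))\<^sup>2 = ?d\<^sup>2 + real N * (avg_comp N z - c)\<^sup>2" for c
  proof -
    have "(x @\<^sub>v z) - ?p c = (x - \<theta> \<cdot>\<^sub>v ones_vec N) @\<^sub>v (z - (?z + c \<cdot>\<^sub>v ones_vec N))"
      using x z by (intro eq_vecI) (auto simp: carrier_vecD[OF dual_offset_carrier])
    moreover have "z - (?z + c \<cdot>\<^sub>v ones_vec N) = (avg_comp N z - c) \<cdot>\<^sub>v ones_vec N + (mean_free N z - ?z)"
      using z by (intro eq_vecI) (auto simp: mean_free_def carrier_vecD[OF dual_offset_carrier] algebra_simps)
    ultimately show ?thesis
      using eucl_norm_ones_plus_orthogonal[OF h, of "avg_comp N z - c"]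
      by (simp add: eucl_norm_append_power2)
  qed
  have "(INF c. eucl_norm ((x @\<^sub>v z) - ?p c)) = ?d"
  proof (rule antisym)
    have "eucl_norm ((x @\<^sub>v z) - ?p (avg_comp N z)) = ?d"
      using dist[of "avg_comp N z"] by simp
    moreover have bdd: "bdd_below (range (\<lambda>c. eucl_norm ((x @\<^sub>v z) - ?p c)))"
      by (rule bdd_belowI2[of _ 0]) simp
    ultimately show "(INF c. eucl_norm ((x @\<^sub>v z) - ?p c)) \<le> ?d"
      using cINF_lower[of "\<lambda>c. eucl_norm ((x @\<^sub>v z) - ?p c)" UNIV "avg_comp N z"] bdd by simp
    show "?d \<le> (INF c. eucl_norm ((x @\<^sub>v z) - ?p c))"
    proof (rule cINF_greatest)
      fix c show "?d \<le> eucl_norm ((x @\<^sub>v z) - ?p c)"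
        by (rule power2_le_imp_le) (simp_all add: dist)
    qed simp
  qed
  then show ?thesis by (simp add: dist_to_set_def T image_image)
qed

end

section \<open>Strong convexity in one variable\<close>

text \<open>
  Subtracting \<open>c/2 x\<^sup>2\<close> leaves a convex function; adding its tangent inequalities at x and at y
  gives the claim.
\<close>

lemma strongly_convex_imp_deriv_strongly_monotone:
  assumes "strongly_convex g" and deriv: "\<And>x. (g has_real_derivative g' x) (at x)"
  obtains c where "0 < c" "\<And>x y. c * (x - y)\<^sup>2 \<le> (g' x - g' y) * (x - y)"
proof -
  obtain c where c: "c > 0" and conv: "\<And>x y u. u \<in> {0..1} \<Longrightarrow>
     g (u * x + (1 - u) * y) \<le> u * g x + (1 - u) * g y - c / 2 * u * (1 - u) * (x - y)\<^sup>2"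
    using assms(1) unfolding strongly_convex_def by blast
  define h where "h x = g x - c / 2 * x\<^sup>2" for x
  have "convex_on UNIV h"
  proof (rule convex_onI)
    fix t x y :: real assume t: "0 < t" "t < 1"
    have "g (t * y + (1 - t) * x) \<le> t * g y + (1 - t) * g x - c / 2 * t * (1 - t) * (y - x)\<^sup>2"
      using conv[of t y x] t by simp
    moreover have "(1 - t) * h x + t * h y = t * g y + (1 - t) * g x
        - c / 2 * t * (1 - t) * (y - x)\<^sup>2 - c / 2 * (t * y + (1 - t) * x)\<^sup>2"
      by (simp add: h_def power2_eq_square field_simps)
    moreover have "(1 - t) *\<^sub>R x + t *\<^sub>R y = t * y + (1 - t) * x" by simp
    ultimately show "h ((1 - t) *\<^sub>R x + t *\<^sub>R y) \<le> (1 - t) * h x + t * h y"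
      by (simp only: h_def)
  qed simp
  moreover have "(h has_real_derivative (g' x - c * x)) (at x)" for x
    unfolding h_def by (auto intro!: derivative_eq_intros deriv)
  ultimately have tangent: "h y - h x \<ge> (g' x - c * x) * (y - x)" for x y
    by (intro convex_on_imp_above_tangent[of UNIV]) auto
  have "c * (x - y)\<^sup>2 \<le> (g' x - g' y) * (x - y)" for x y
    using tangent[of x y] tangent[of y x] by (simp add: power2_eq_square algebra_simps)
  then show thesis using that c by blast
qed

lemma strongly_monotone_unique_zero:
  fixes F :: "real \<Rightarrow> real"
  assumes "continuous_on UNIV F" "0 < c" and mono: "\<And>x y. c * (x - y)\<^sup>2 \<le> (F x - F y) * (x - y)"
  obtains \<theta> where "\<And>\<eta>. F \<eta> = 0 \<longleftrightarrow> \<eta> = \<theta>"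
proof -
  \<comment> \<open>growth at rate c forces a sign change within this distance of 0\<close>
  define b where "b = \<bar>F 0\<bar> / c"
  have incr: "c * (x - y) \<le> F x - F y" if "y \<le> x" for x y
    using mono[of x y] that by (cases "y = x") (auto simp: power2_eq_square mult.assoc[symmetric])
  have b: "0 \<le> b" "c * b = \<bar>F 0\<bar>" using assms(2) by (auto simp: b_def)
  have "F (- b) \<le> 0" "0 \<le> F b" using incr[of "-b" 0] incr[of 0 b] b by auto
  then obtain \<theta> where "F \<theta> = 0"
    using IVT'[of F "-b" 0 b] b continuous_on_subset[OF assms(1), of "{-b..b}"] by auto
  moreover have "\<eta> = \<theta>" if "F \<eta> = 0" for \<eta>
  proof -
    have "c * (\<eta> - \<theta>)\<^sup>2 \<le> 0" using mono[of \<eta> \<theta>] that \<open>F \<theta> = 0\<close> by simp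
    then show ?thesis using assms(2) by (simp add: mult_le_0_iff)
  qed
  ultimately show thesis using that by blast
qed

text \<open>
  In one dimension no square has to be expanded: the two hypotheses place \<open>h \<phi>\<close> between h c m and m,
  so the step shrinks m without changing its sign.
\<close>

lemma scalar_gradient_step:
  fixes m \<phi> h c L :: real
  assumes "c * m\<^sup>2 \<le> \<phi> * m" "\<bar>\<phi>\<bar> \<le> L * \<bar>m\<bar>" "0 \<le> h" "h * L \<le> 1"
  shows "\<bar>m - h * \<phi>\<bar> \<le> (1 - h * c) * \<bar>m\<bar>"
proof (cases "m = 0")
  case True then show ?thesis using assms by simp
next
  case False
  have "h * \<bar>\<phi>\<bar> \<le> h * (L * \<bar>m\<bar>)" using assms by (intro mult_left_mono) auto
  also have "\<dots> \<le> 1 * \<bar>m\<bar>" unfolding mult.assoc[symmetric] using assms by (intro mult_right_mono) auto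
  finally have small: "\<bar>h * \<phi>\<bar> \<le> \<bar>m\<bar>" using assms(3) by (simp add: abs_mult)
  have "c * \<bar>m\<bar> \<le> sgn m * \<phi>"
    using assms(1) False by (cases "m > 0") (auto simp: power2_eq_square mult.assoc[symmetric] mult_le_cancel_right)
  then have "h * (c * \<bar>m\<bar>) \<le> h * (sgn m * \<phi>)" using assms by (intro mult_left_mono) auto
  then show ?thesis using small False by (cases "m > 0") (auto simp: algebra_simps abs_if split: if_splits)
qed

section \<open>Running suprema and perturbed contractions\<close>

lemma running_sup_upper: "k \<le> t \<Longrightarrow> a k \<le> running_sup a (int t)"
  unfolding running_sup_def by (auto intro!: cSUP_upper bdd_above_finite)

lemma running_sup_mono:
  assumes "\<And>k. 0 \<le> a k"
  shows "running_sup a (int t - 1) \<le> running_sup a (int t)"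
proof (cases t)
  case 0 then show ?thesis using assms running_sup_upper[of 0 0 a] by (simp add: running_sup_def)
next
  case (Suc n)
  then have "running_sup a (int t - 1) = (SUP k\<in>{0..n}. a k)" by (simp add: running_sup_def)
  also have "\<dots> \<le> running_sup a (int t)"
    using Suc by (intro cSUP_least running_sup_upper) auto
  finally show ?thesis .
qed

lemma running_sup_le:
  assumes "\<And>k. a k \<le> M" "0 \<le> M"
  shows "running_sup a t \<le> M"
  using assms unfolding running_sup_def by (auto intro!: cSUP_least)

text \<open>
  The running suprema are nondecreasing, so each step can use the current value in place of all the
  earlier ones; the geometric series then sums to the factor \<open>1 / (1 - \<mu>)\<close>.
\<close>

lemma contraction_with_inputs:
  fixes V a p :: "nat \<Rightarrow> real"
  assumes step: "\<And>t. V (Suc t) \<le> \<mu> * V t + a t + b * p t"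
    and "0 \<le> \<mu>" "\<mu> < 1" "0 \<le> b" and nonneg: "\<And>t. 0 \<le> a t" "\<And>t. 0 \<le> p t"
  shows "V t \<le> \<mu> ^ t * V 0 + (running_sup a (int t - 1) + b * running_sup p (int t - 1)) / (1 - \<mu>)"
proof (induction t)
  case 0 then show ?case by (simp add: running_sup_def)
next
  case (Suc t)
  define r where "r = running_sup a (int t - 1) + b * running_sup p (int t - 1)"
  define R where "R = running_sup a (int t) + b * running_sup p (int t)"
  have "r \<le> R" unfolding r_def R_def
    using assms by (intro add_mono mult_left_mono running_sup_mono) auto
  have "a t + b * p t \<le> R" unfolding R_def
    using assms by (intro add_mono mult_left_mono running_sup_upper) auto
  then have "V (Suc t) \<le> \<mu> * (\<mu> ^ t * V 0 + r / (1 - \<mu>)) + R"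
    using step[of t] mult_left_mono[OF Suc.IH \<open>0 \<le> \<mu>\<close>] by (simp add: r_def)
  also have "\<dots> \<le> \<mu> * (\<mu> ^ t * V 0 + R / (1 - \<mu>)) + R"
    using assms \<open>r \<le> R\<close> by (intro add_mono mult_left_mono divide_right_mono) auto
  also have "\<dots> = \<mu> ^ Suc t * V 0 + R / (1 - \<mu>)"
    using assms by (simp add: field_simps)
  finally show ?case by (simp add: R_def)
qed

lemma vec_seq_boundedI: "(\<And>t. eucl_norm (s t) \<le> B) \<Longrightarrow> vec_seq_bounded s"
  unfolding vec_seq_bounded_def by (rule BseqI'[of _ B]) simp

lemma vec_seq_boundedE:
  assumes "vec_seq_bounded s"
  obtains B where "0 < B" "\<And>t. eucl_norm (s t) \<le> B"
  using assms unfolding vec_seq_bounded_def by (elim BseqE) (auto intro: that)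

section \<open>One step of the perturbed algorithm\<close>

text \<open>
  L bounds the Lipschitz constants of all the derivatives, c is a modulus of strong monotonicity of
  the total derivative, and \<delta> is the coercivity constant of K - K K on mean-free vectors.
\<close>

locale gradient_tracking = consensus +
  fixes f :: "nat \<Rightarrow> real \<Rightarrow> real" and L c \<theta> \<delta> :: real
  assumes L: "0 \<le> L" and lip: "\<And>i s r. i < N \<Longrightarrow> \<bar>deriv (f i) s - deriv (f i) r\<bar> \<le> L * \<bar>s - r\<bar>"
    and c: "0 < c" and mono: "\<And>s r. c * (s - r)\<^sup>2 \<le> ((\<Sum>i<N. deriv (f i) s) - (\<Sum>i<N. deriv (f i) r)) * (s - r)"
    and opt: "(\<Sum>i<N. deriv (f i) \<theta>) = 0"
    and \<delta>: "0 < \<delta>" "\<delta> \<le> 1"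
    and gap: "\<And>y. y \<in> carrier_vec N \<Longrightarrow> ones_vec N \<bullet> y = 0 \<Longrightarrow>
      \<delta> * (y \<bullet> y) \<le> y \<bullet> (K *\<^sub>v y) - (K *\<^sub>v y) \<bullet> (K *\<^sub>v y)"
begin

abbreviation primal_err :: "real vec \<Rightarrow> real vec" where
  "primal_err x \<equiv> x - \<theta> \<cdot>\<^sub>v ones_vec N"

abbreviation dual_err :: "real \<Rightarrow> real vec \<Rightarrow> real vec" where
  "dual_err \<gamma> z \<equiv> mean_free N z - dual_offset f \<gamma> \<theta>"

definition disp_size :: "real \<Rightarrow> real vec \<Rightarrow> real vec \<Rightarrow> real" where
  "disp_size \<gamma> x z = hex_norm (mean_free N x) (dual_err \<gamma> z)"

lemma grad_vec_carrier [simp]: "x \<in> carrier_vec N \<Longrightarrow> grad_vec f x \<in> carrier_vec N"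
  by (simp add: grad_vec_def)

lemma primal_err_decomp:
  assumes "x \<in> carrier_vec N"
  shows "avg_comp N (primal_err x) = avg_comp N x - \<theta>" "mean_free N (primal_err x) = mean_free N x"
proof -
  show "avg_comp N (primal_err x) = avg_comp N x - \<theta>"
    using assms by (simp add: avg_comp_minus avg_comp_smult)
  show "mean_free N (primal_err x) = mean_free N x"
    using assms by (intro eq_vecI) (auto simp: mean_free_def avg_comp_minus avg_comp_smult algebra_simps)
qed

lemma disp_size_nonneg: "x \<in> carrier_vec N \<Longrightarrow> z \<in> carrier_vec N \<Longrightarrow> 0 \<le> disp_size \<gamma> x z"
  unfolding disp_size_def by (intro hex_norm_nonneg[of _ N]) auto

lemma mean_free_le_disp_size:
  assumes "x \<in> carrier_vec N" "z \<in> carrier_vec N"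
  shows "eucl_norm (mean_free N x) \<le> 2 * disp_size \<gamma> x z" "eucl_norm (dual_err \<gamma> z) \<le> 2 * disp_size \<gamma> x z"
  using assms eucl_norm_append_le_hex_norm[of "mean_free N x" N "dual_err \<gamma> z"]
    eucl_norm_le_append[where u="mean_free N x" and v="dual_err \<gamma> z"] by (auto simp: disp_size_def)

lemma primal_err_le:
  assumes "x \<in> carrier_vec N" "z \<in> carrier_vec N"
  shows "eucl_norm (primal_err x) \<le> real N * \<bar>avg_comp N x - \<theta>\<bar> + 2 * disp_size \<gamma> x z"
  using eucl_norm_le_avg_mean_free[of "primal_err x"] mean_free_le_disp_size[OF assms, of \<gamma>]
    primal_err_decomp[OF assms(1)] assms by simp

text \<open>
  K drops out of the mean, which thus performs a gradient step for the total cost, except that the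
  derivatives are taken at the entries of x instead of at their mean. The entries differ from the
  mean by at most the norm of the mean-free part.
\<close>

lemma average_step:
  assumes \<gamma>: "0 < \<gamma>" "\<gamma> * L \<le> 1"
    and carr: "x \<in> carrier_vec N" "z \<in> carrier_vec N" "w \<in> carrier_vec N"
    and x': "x' = (1\<^sub>m N - K) *\<^sub>v x - K *\<^sub>v z - \<gamma> \<cdot>\<^sub>v grad_vec f x + w"
  shows "\<bar>avg_comp N x' - \<theta>\<bar> \<le> (1 - \<gamma> * c / N) * \<bar>avg_comp N x - \<theta>\<bar>
    + \<gamma> * L * eucl_norm (mean_free N x) + \<bar>avg_comp N w\<bar>"
proof -
  define s where "s = avg_comp N x"
  define \<phi> where "\<phi> = (\<Sum>i<N. deriv (f i) s)"
  have Npos: "0 < real N" using N by simp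
  have IK: "(1\<^sub>m N - K) *\<^sub>v x = x - K *\<^sub>v x"
    using K carr by (simp add: minus_mult_distrib_mat_vec[of _ N N])
  have "avg_comp N (K *\<^sub>v y) = 0" if "y \<in> carrier_vec N" for y
    using ones_K[OF that] by (rule avg_comp_0)
  then have "avg_comp N x' = s - \<gamma> * avg_comp N (grad_vec f x) + avg_comp N w"
    using carr by (simp add: x' IK avg_comp_add avg_comp_minus avg_comp_smult s_def)
  moreover have "avg_comp N (grad_vec f x) = (\<Sum>i<N. deriv (f i) (x $ i)) / N"
    using carr by (simp add: avg_comp_sum) (simp add: grad_vec_def)
  ultimately have eq: "avg_comp N x' - \<theta> = ((s - \<theta>) - \<gamma> / N * \<phi>)
      - \<gamma> / N * ((\<Sum>i<N. deriv (f i) (x $ i)) - \<phi>) + avg_comp N w"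
    by (simp add: algebra_simps diff_divide_distrib)
  have "\<bar>(s - \<theta>) - \<gamma> / N * \<phi>\<bar> \<le> (1 - \<gamma> / N * c) * \<bar>s - \<theta>\<bar>"
  proof (rule scalar_gradient_step)
    show "c * (s - \<theta>)\<^sup>2 \<le> \<phi> * (s - \<theta>)" using mono[of s \<theta>] by (simp add: \<phi>_def opt)
    have "\<bar>\<phi>\<bar> = \<bar>\<Sum>i<N. deriv (f i) s - deriv (f i) \<theta>\<bar>" by (simp add: \<phi>_def sum_subtractf opt)
    also have "\<dots> \<le> (\<Sum>i<N. L * \<bar>s - \<theta>\<bar>)" by (rule order_trans[OF sum_abs sum_mono]) (simp add: lip)
    finally show "\<bar>\<phi>\<bar> \<le> (N * L) * \<bar>s - \<theta>\<bar>" by simp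
  qed (use \<gamma> Npos in simp_all)
  moreover have "\<bar>(\<Sum>i<N. deriv (f i) (x $ i)) - \<phi>\<bar> \<le> N * (L * eucl_norm (mean_free N x))"
  proof -
    have "\<bar>(\<Sum>i<N. deriv (f i) (x $ i)) - \<phi>\<bar> \<le> (\<Sum>i<N. \<bar>deriv (f i) (x $ i) - deriv (f i) s\<bar>)"
      unfolding \<phi>_def sum_subtractf[symmetric] by (rule sum_abs)
    also have "\<dots> \<le> (\<Sum>i<N. L * eucl_norm (mean_free N x))"
    proof (rule sum_mono)
      fix i assume "i \<in> {..<N}"
      then have i: "i < N" by simp
      have "\<bar>x $ i - s\<bar> = \<bar>mean_free N x $ i\<bar>" using i carr by (simp add: mean_free_def s_def)
      also have "\<dots> \<le> eucl_norm (mean_free N x)"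
        using i by (intro abs_index_le_eucl_norm) simp
      finally have "L * \<bar>x $ i - s\<bar> \<le> L * eucl_norm (mean_free N x)" using L by (intro mult_left_mono)
      then show "\<bar>deriv (f i) (x $ i) - deriv (f i) s\<bar> \<le> L * eucl_norm (mean_free N x)"
        using lip[OF i, of "x $ i" s] by linarith
    qed
    finally show ?thesis by simp
  qed
  then have "\<gamma> / N * \<bar>(\<Sum>i<N. deriv (f i) (x $ i)) - \<phi>\<bar> \<le> \<gamma> / N * (N * (L * eucl_norm (mean_free N x)))"
    using \<gamma> by (intro mult_left_mono) auto
  then have "\<bar>\<gamma> / N * ((\<Sum>i<N. deriv (f i) (x $ i)) - \<phi>)\<bar> \<le> \<gamma> * L * eucl_norm (mean_free N x)"
    using \<gamma> Npos by (simp add: abs_mult)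
  moreover have "\<bar>p - q + r\<bar> \<le> \<bar>p\<bar> + \<bar>q\<bar> + \<bar>r\<bar>" for p q r :: real by linarith
  then have "\<bar>avg_comp N x' - \<theta>\<bar> \<le> \<bar>(s - \<theta>) - \<gamma> / N * \<phi>\<bar>
      + \<bar>\<gamma> / N * ((\<Sum>i<N. deriv (f i) (x $ i)) - \<phi>)\<bar> + \<bar>avg_comp N w\<bar>"
    unfolding eq .
  moreover have "\<gamma> / N * c = \<gamma> * c / N" by simp
  ultimately show ?thesis unfolding s_def[symmetric] by (simp only:)
qed

text \<open>
  In error coordinates the gradient at the optimum cancels against K applied to the equilibrium
  offset. What remains is the linear map of \<open>hex_norm_step\<close>, the difference of two gradients, and
  the mean-free parts of the perturbations.
\<close>

lemma dispersion_step:
  assumes \<gamma>: "0 < \<gamma>"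
    and carr: "x \<in> carrier_vec N" "z \<in> carrier_vec N" "w \<in> carrier_vec N" "\<nu> \<in> carrier_vec N"
    and x': "x' = (1\<^sub>m N - K) *\<^sub>v x - K *\<^sub>v z - \<gamma> \<cdot>\<^sub>v grad_vec f x + w"
    and z': "z' = z + K *\<^sub>v x + \<nu>"
  shows "disp_size \<gamma> x' z' \<le> (1 - \<delta> / 2) * disp_size \<gamma> x z + \<gamma> * L * eucl_norm (primal_err x)
    + 2 * eucl_norm (disp_comp S w @\<^sub>v disp_comp S \<nu>)"
proof -
  define u v where "u = mean_free N x" and "v = dual_err \<gamma> z"
  define g where "g = mean_free N (grad_vec f x - grad_vec f (\<theta> \<cdot>\<^sub>v ones_vec N))"
  let ?z = "dual_offset f \<gamma> \<theta>"
  have uv: "u \<in> carrier_vec N" "v \<in> carrier_vec N" "g \<in> carrier_vec N"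
    using carr by (simp_all add: u_def v_def g_def)
  have mf: "mean_free N w \<in> carrier_vec N" "mean_free N \<nu> \<in> carrier_vec N" using carr by simp_all
  have orth: "ones_vec N \<bullet> u = 0" "ones_vec N \<bullet> v = 0"
    using carr by (simp_all add: u_def v_def scalar_prod_minus_distrib[of _ N] ones_dual_offset)
  have IK: "(1\<^sub>m N - K) *\<^sub>v x = x - K *\<^sub>v x"
    using K carr by (simp add: minus_mult_distrib_mat_vec[of _ N N])
  have Ku: "K *\<^sub>v u = K *\<^sub>v x" using carr by (simp add: u_def K_mean_free)
  have Kv: "K *\<^sub>v v = K *\<^sub>v z + \<gamma> \<cdot>\<^sub>v mean_free N (grad_vec f (\<theta> \<cdot>\<^sub>v ones_vec N))"
    using carr K
    by (simp add: v_def mult_minus_distrib_mat_vec[of _ N N] K_mean_free K_dual_offset)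
      (intro eq_vecI; simp add: grad_vec_def mean_free_def)
  have dims: "dim_vec (K *\<^sub>v x) = N" "dim_vec (K *\<^sub>v z) = N" "dim_row K = N" using K by simp_all
  have "mean_free N x' = u - K *\<^sub>v x - K *\<^sub>v z - \<gamma> \<cdot>\<^sub>v mean_free N (grad_vec f x) + mean_free N w"
    using carr by (simp add: x' IK mean_free_add mean_free_minus mean_free_smult mean_free_K u_def)
  also have "\<dots> = (u - K *\<^sub>v u - K *\<^sub>v v) + ((- \<gamma>) \<cdot>\<^sub>v g + mean_free N w)"
    unfolding Ku Kv g_def using carr uv mf
    by (intro eq_vecI)
      (auto simp: mean_free_minus dims algebra_simps simp del: index_mult_mat_vec)
  finally have u': "mean_free N x' = (u - K *\<^sub>v u - K *\<^sub>v v) + ((- \<gamma>) \<cdot>\<^sub>v g + mean_free N w)" .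
  have "dual_err \<gamma> z' = mean_free N z + K *\<^sub>v x + mean_free N \<nu> - ?z"
    using carr by (simp add: z' mean_free_add mean_free_K assoc_add_vec[of _ N])
  also have "\<dots> = (v + K *\<^sub>v u) + (0\<^sub>v N + mean_free N \<nu>)"
    unfolding Ku v_def using carr mf
    by (intro eq_vecI)
      (auto simp: dims carrier_vecD[OF dual_offset_carrier] algebra_simps simp del: index_mult_mat_vec)
  finally have v': "dual_err \<gamma> z' = (v + K *\<^sub>v u) + (0\<^sub>v N + mean_free N \<nu>)" .
  have "disp_size \<gamma> x' z' \<le> hex_norm (u - K *\<^sub>v u - K *\<^sub>v v) (v + K *\<^sub>v u)
      + hex_norm ((- \<gamma>) \<cdot>\<^sub>v g + mean_free N w) (0\<^sub>v N + mean_free N \<nu>)"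
    unfolding disp_size_def u' v' using uv mf by (intro hex_norm_triangle[of _ N]) auto
  also have "hex_norm ((- \<gamma>) \<cdot>\<^sub>v g + mean_free N w) (0\<^sub>v N + mean_free N \<nu>)
      \<le> hex_norm ((- \<gamma>) \<cdot>\<^sub>v g) (0\<^sub>v N) + hex_norm (mean_free N w) (mean_free N \<nu>)"
    using uv mf by (intro hex_norm_triangle[of _ N]) auto
  also have "hex_norm ((- \<gamma>) \<cdot>\<^sub>v g) (0\<^sub>v N) \<le> \<gamma> * L * eucl_norm (primal_err x)"
  proof -
    have "eucl_norm g \<le> eucl_norm (grad_vec f x - grad_vec f (\<theta> \<cdot>\<^sub>v ones_vec N))"
      unfolding g_def using carr by (intro eucl_norm_mean_free_le) simp
    also have "\<dots> \<le> L * eucl_norm (primal_err x)"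
      using carr L by (intro eucl_norm_componentwise_le[of _ N]) (auto simp: grad_vec_def lip)
    finally have "\<gamma> * eucl_norm g \<le> \<gamma> * (L * eucl_norm (primal_err x))"
      using \<gamma> by (intro mult_left_mono) auto
    then show ?thesis using \<gamma> uv by (simp add: hex_norm_left eucl_norm_smult mult.assoc)
  qed
  also have "hex_norm (mean_free N w) (mean_free N \<nu>) \<le> 2 * eucl_norm (disp_comp S w @\<^sub>v disp_comp S \<nu>)"
  proof -
    have "(eucl_norm (mean_free N w @\<^sub>v mean_free N \<nu>))\<^sup>2 = (eucl_norm (disp_comp S w @\<^sub>v disp_comp S \<nu>))\<^sup>2"
      using carr by (simp add: eucl_norm_append_power2 eucl_norm_disp_comp)
    then have "eucl_norm (mean_free N w @\<^sub>v mean_free N \<nu>) = eucl_norm (disp_comp S w @\<^sub>v disp_comp S \<nu>)"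
      by simp
    then show ?thesis using hex_norm_le[OF mf] by simp
  qed
  also have "hex_norm (u - K *\<^sub>v u - K *\<^sub>v v) (v + K *\<^sub>v u) \<le> (1 - \<delta> / 2) * disp_size \<gamma> x z"
    unfolding disp_size_def u_def[symmetric] v_def[symmetric]
  proof (rule hex_norm_step[OF K K_sym uv(1,2) _ \<delta>(2)])
    fix y assume "y \<in> {u + v, u - v}"
    then have "y \<in> carrier_vec N" "ones_vec N \<bullet> y = 0"
      using uv orth by (auto simp: scalar_prod_add_distrib[of _ N] scalar_prod_minus_distrib[of _ N])
    then show "\<delta> * (y \<bullet> y) \<le> y \<bullet> (K *\<^sub>v y) - (K *\<^sub>v y) \<bullet> (K *\<^sub>v y)" by (rule gap)
  qed
  finally show ?thesis by simp
qed

section \<open>The Lyapunov function\<close>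

lemma opt_iff: "(\<Sum>i<N. deriv (f i) \<eta>) = 0 \<longleftrightarrow> \<eta> = \<theta>"
proof
  assume "(\<Sum>i<N. deriv (f i) \<eta>) = 0"
  then have "c * (\<eta> - \<theta>)\<^sup>2 \<le> 0" using mono[of \<eta> \<theta>] opt by simp
  then show "\<eta> = \<theta>" using c by (simp add: mult_le_0_iff)
qed (simp add: opt)

text \<open>
  Chosen such that \<open>\<beta> L N \<le> c / (2 N)\<close>: through the weight \<beta>, the mean error feeds back into
  itself with at most half of its decay. The summand 1 covers L = 0.
\<close>

definition \<beta> :: real where "\<beta> = c / (2 * (real N)\<^sup>2 * (L + 1))"

text \<open>
  The three bounds make the gradient step of the mean contracting, keep the overall rate nonnegative,
  and let the decay \<delta>/2 of the dispersion absorb the terms of order \<gamma>, respectively.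
\<close>

definition \<gamma>\<^sub>0 :: real where
  "\<gamma>\<^sub>0 = Min {1 / (L + 1), real N / c, \<beta> * \<delta> / (2 * (2 * \<beta> * L + 2 * L + \<beta> * c / (2 * N) + 1))}"

definition lyap :: "real \<Rightarrow> real vec \<Rightarrow> real vec \<Rightarrow> real" where
  "lyap \<gamma> x z = \<bar>avg_comp N x - \<theta>\<bar> + \<beta> * disp_size \<gamma> x z"

lemma \<beta>_pos: "0 < \<beta>"
  using N c L by (simp add: \<beta>_def)

lemma \<gamma>\<^sub>0_pos: "0 < \<gamma>\<^sub>0"
proof -
  have "0 \<le> 2 * \<beta> * L + 2 * L + \<beta> * c / (2 * N)" using \<beta>_pos L c by simp
  then have "0 < \<beta> * \<delta> / (2 * (2 * \<beta> * L + 2 * L + \<beta> * c / (2 * N) + 1))"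
    using \<beta>_pos \<delta> by (intro divide_pos_pos mult_pos_pos) auto
  then show ?thesis using N c L by (simp add: \<gamma>\<^sub>0_def)
qed

lemma small_step:
  assumes "0 < \<gamma>" "\<gamma> < \<gamma>\<^sub>0"
  shows "\<gamma> * L \<le> 1" "\<gamma> * c \<le> N" "\<gamma> * (2 * \<beta> * L + 2 * L + \<beta> * c / (2 * N)) \<le> \<beta> * \<delta> / 2"
proof -
  let ?D = "2 * \<beta> * L + 2 * L + \<beta> * c / (2 * N)"
  have D: "0 \<le> ?D" using \<beta>_pos L c by simp
  have "\<gamma> < 1 / (L + 1)" "\<gamma> < N / c" "\<gamma> < \<beta> * \<delta> / (2 * (?D + 1))"
    using assms(2) by (simp_all add: \<gamma>\<^sub>0_def)
  then have *: "\<gamma> * (L + 1) < 1" "\<gamma> * c < N" "\<gamma> * (2 * (?D + 1)) < \<beta> * \<delta>"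
    using L c D by (simp_all add: pos_less_divide_eq)
  show "\<gamma> * L \<le> 1" "\<gamma> * c \<le> N" using *(1,2) assms(1) by (simp_all add: algebra_simps)
  have "\<gamma> * (2 * (?D + 1)) = 2 * (\<gamma> * ?D) + 2 * \<gamma>" by (simp only: distrib_left)
  then show "\<gamma> * ?D \<le> \<beta> * \<delta> / 2" using *(3) assms(1) by linarith
qed

text \<open>
  The mean and dispersion estimates form a linear comparison system with a nonnegative 2 by 2 matrix;
  the row vector (1, \<beta>) is shown to be contracted by it with factor \<open>1 - \<gamma> c / (2 N)\<close>.
\<close>

lemma lyap_step:
  assumes \<gamma>: "0 < \<gamma>" "\<gamma> < \<gamma>\<^sub>0" and sol: "solution_tuple N K f \<gamma> x z w \<nu>"
  shows "lyap \<gamma> (x (Suc t)) (z (Suc t)) \<le> (1 - \<gamma> * c / (2 * N)) * lyap \<gamma> (x t) (z t)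
    + \<bar>avg_comp N (w t)\<bar> + 2 * \<beta> * eucl_norm (disp_comp S (w t) @\<^sub>v disp_comp S (\<nu> t))"
proof -
  note s = sol[unfolded solution_tuple_def, rule_format, of t]
  have carr: "x t \<in> carrier_vec N" "z t \<in> carrier_vec N" "w t \<in> carrier_vec N" "\<nu> t \<in> carrier_vec N"
    using s by auto
  define m where "m = \<bar>avg_comp N (x t) - \<theta>\<bar>"
  define H where "H = disp_size \<gamma> (x t) (z t)"
  define a where "a = \<bar>avg_comp N (w t)\<bar>"
  define p where "p = eucl_norm (disp_comp S (w t) @\<^sub>v disp_comp S (\<nu> t))"
  have m: "0 \<le> m" by (simp add: m_def)
  have H: "0 \<le> H" unfolding H_def using carr by (intro disp_size_nonneg)
  have Npos: "0 < real N" using N by simp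
  have \<gamma>L: "0 \<le> \<gamma> * L" using \<gamma> L by simp
  have "\<bar>avg_comp N (x (Suc t)) - \<theta>\<bar> \<le> (1 - \<gamma> * c / N) * m + \<gamma> * L * eucl_norm (mean_free N (x t)) + a"
    unfolding m_def a_def using s by (intro average_step[OF \<gamma>(1) small_step(1)[OF \<gamma>] carr(1,2,3)]) auto
  moreover have "\<gamma> * L * eucl_norm (mean_free N (x t)) \<le> \<gamma> * L * (2 * H)"
    unfolding H_def using mean_free_le_disp_size[OF carr(1,2)] by (intro mult_left_mono[OF _ \<gamma>L]) auto
  ultimately have avg: "\<bar>avg_comp N (x (Suc t)) - \<theta>\<bar> \<le> (1 - \<gamma> * c / N) * m + \<gamma> * L * (2 * H) + a"
    by linarith
  have "disp_size \<gamma> (x (Suc t)) (z (Suc t)) \<le> (1 - \<delta> / 2) * H + \<gamma> * L * eucl_norm (primal_err (x t)) + 2 * p"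
    unfolding H_def p_def using s by (intro dispersion_step[OF \<gamma>(1) carr]) auto
  moreover have "\<gamma> * L * eucl_norm (primal_err (x t)) \<le> \<gamma> * L * (N * m + 2 * H)"
    unfolding H_def m_def by (intro mult_left_mono[OF _ \<gamma>L] primal_err_le carr)
  ultimately have disp: "disp_size \<gamma> (x (Suc t)) (z (Suc t)) \<le> (1 - \<delta> / 2) * H + \<gamma> * L * (N * m + 2 * H) + 2 * p"
    by linarith
  have "lyap \<gamma> (x (Suc t)) (z (Suc t)) \<le> ((1 - \<gamma> * c / N) * m + \<gamma> * L * (2 * H) + a)
      + \<beta> * ((1 - \<delta> / 2) * H + \<gamma> * L * (N * m + 2 * H) + 2 * p)"
    unfolding lyap_def using \<beta>_pos by (intro add_mono avg mult_left_mono[OF disp]) simp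
  also have "\<dots> = (1 - \<gamma> * c / N + \<gamma> * (\<beta> * L * N)) * m
      + (\<beta> - \<beta> * \<delta> / 2 + \<gamma> * (2 * \<beta> * L + 2 * L)) * H + a + 2 * \<beta> * p"
    by (simp add: algebra_simps)
  also have "\<dots> \<le> (1 - \<gamma> * c / (2 * N)) * m + (1 - \<gamma> * c / (2 * N)) * \<beta> * H + a + 2 * \<beta> * p"
  proof -
    have "\<beta> * L * N \<le> \<beta> * (L + 1) * N" using \<beta>_pos by (intro mult_right_mono mult_left_mono) auto
    also have "\<dots> = c / (2 * N)" using L Npos by (simp add: \<beta>_def power2_eq_square)
    finally have "\<gamma> * (\<beta> * L * N) \<le> \<gamma> * (c / (2 * N))" using \<gamma> by (intro mult_left_mono) auto
    moreover have "\<gamma> * c / N = 2 * (\<gamma> * (c / (2 * N)))" by simp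
    moreover have "\<gamma> * c / (2 * N) = \<gamma> * (c / (2 * N))" by simp
    ultimately have m1: "1 - \<gamma> * c / N + \<gamma> * (\<beta> * L * N) \<le> 1 - \<gamma> * c / (2 * N)" by linarith
    have "\<gamma> * (2 * \<beta> * L + 2 * L + \<beta> * c / (2 * N)) = \<gamma> * (2 * \<beta> * L + 2 * L) + \<gamma> * c / (2 * N) * \<beta>"
      by (simp add: distrib_left)
    then have m2: "\<beta> - \<beta> * \<delta> / 2 + \<gamma> * (2 * \<beta> * L + 2 * L) \<le> (1 - \<gamma> * c / (2 * N)) * \<beta>"
      using small_step(3)[OF \<gamma>] by (simp add: left_diff_distrib)
    show ?thesis by (intro add_mono mult_right_mono m1 m2 m H order_refl)
  qed
  also have "\<dots> = (1 - \<gamma> * c / (2 * N)) * lyap \<gamma> (x t) (z t) + a + 2 * \<beta> * p"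
    by (simp add: lyap_def m_def H_def distrib_left mult.assoc)
  finally show ?thesis by (simp add: a_def p_def)
qed

definition opt_dist :: "real \<Rightarrow> real vec \<Rightarrow> real vec \<Rightarrow> real" where
  "opt_dist \<gamma> x z = dist_to_set (x @\<^sub>v z) (target_set N K f S \<gamma>)"

lemma opt_dist_eq:
  "x \<in> carrier_vec N \<Longrightarrow> z \<in> carrier_vec N \<Longrightarrow> opt_dist \<gamma> x z = eucl_norm (primal_err x @\<^sub>v dual_err \<gamma> z)"
  unfolding opt_dist_def by (rule dist_to_target_set[OF opt_iff])

lemma lyap_le_opt_dist:
  assumes "x \<in> carrier_vec N" "z \<in> carrier_vec N"
  shows "lyap \<gamma> x z \<le> (1 + 2 * \<beta>) * opt_dist \<gamma> x z"
proof -
  have px: "primal_err x \<in> carrier_vec N" using assms by simp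
  have "\<bar>avg_comp N x - \<theta>\<bar> \<le> eucl_norm (primal_err x)"
    using abs_avg_comp_le[OF px] primal_err_decomp[OF assms(1)] by simp
  also have "\<dots> \<le> opt_dist \<gamma> x z" unfolding opt_dist_eq[OF assms] by (rule eucl_norm_le_append)
  finally have 1: "\<bar>avg_comp N x - \<theta>\<bar> \<le> opt_dist \<gamma> x z" .
  have "eucl_norm (mean_free N x @\<^sub>v dual_err \<gamma> z) \<le> opt_dist \<gamma> x z"
  proof (rule power2_le_imp_le)
    have "eucl_norm (mean_free N x) \<le> eucl_norm (primal_err x)"
      using eucl_norm_mean_free_le[OF px] primal_err_decomp[OF assms(1)] by simp
    then show "(eucl_norm (mean_free N x @\<^sub>v dual_err \<gamma> z))\<^sup>2 \<le> (opt_dist \<gamma> x z)\<^sup>2"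
      unfolding opt_dist_eq[OF assms] by (simp add: eucl_norm_append_power2 power_mono)
    show "0 \<le> opt_dist \<gamma> x z" unfolding opt_dist_eq[OF assms] by simp
  qed
  then have "disp_size \<gamma> x z \<le> 2 * opt_dist \<gamma> x z"
    using hex_norm_le[of "mean_free N x" N "dual_err \<gamma> z"] assms by (simp add: disp_size_def)
  then have "\<beta> * disp_size \<gamma> x z \<le> \<beta> * (2 * opt_dist \<gamma> x z)" using \<beta>_pos by (intro mult_left_mono) auto
  then show ?thesis using 1 by (simp add: lyap_def algebra_simps)
qed

lemma opt_dist_le_lyap:
  assumes "x \<in> carrier_vec N" "z \<in> carrier_vec N"
  shows "opt_dist \<gamma> x z \<le> (N + 4 / \<beta>) * lyap \<gamma> x z"
proof -
  define m where "m = \<bar>avg_comp N x - \<theta>\<bar>"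
  define H where "H = disp_size \<gamma> x z"
  have nn: "0 \<le> m" "0 \<le> H" using disp_size_nonneg[OF assms] by (simp_all add: m_def H_def)
  have "opt_dist \<gamma> x z \<le> eucl_norm (primal_err x) + eucl_norm (dual_err \<gamma> z)"
    unfolding opt_dist_eq[OF assms] by (rule eucl_norm_append_le)
  also have "\<dots> \<le> (N * m + 2 * H) + 2 * H"
    unfolding m_def H_def by (intro add_mono primal_err_le mean_free_le_disp_size assms)
  also have "\<dots> \<le> (N + 4 / \<beta>) * (m + \<beta> * H)"
  proof -
    have "(N + 4 / \<beta>) * (m + \<beta> * H) = N * m + 4 * H + (4 / \<beta> * m + N * \<beta> * H)"
      using \<beta>_pos by (simp add: field_simps)
    moreover have "0 \<le> 4 / \<beta> * m + N * \<beta> * H" using \<beta>_pos nn by simp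
    ultimately show ?thesis by linarith
  qed
  finally show ?thesis by (simp add: lyap_def m_def H_def)
qed

lemma opt_dist_estimate:
  assumes \<gamma>: "0 < \<gamma>" "\<gamma> < \<gamma>\<^sub>0" and sol: "solution_tuple N K f \<gamma> x z w \<nu>"
  defines "\<mu> \<equiv> 1 - \<gamma> * c / (2 * N)"
  defines "\<rho> \<equiv> (N + 4 / \<beta>) / (1 - \<mu>)"
  shows "opt_dist \<gamma> (x t) (z t) \<le> (N + 4 / \<beta>) * (1 + 2 * \<beta>) * \<mu> ^ t * opt_dist \<gamma> (x 0) (z 0)
    + \<rho> * running_sup (\<lambda>s. \<bar>avg_comp N (w s)\<bar>) (int t - 1)
    + \<rho> * (2 * \<beta>) * running_sup (\<lambda>s. eucl_norm (disp_comp S (w s) @\<^sub>v disp_comp S (\<nu> s))) (int t - 1)"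
proof -
  let ?a = "running_sup (\<lambda>s. \<bar>avg_comp N (w s)\<bar>) (int t - 1)"
  let ?p = "running_sup (\<lambda>s. eucl_norm (disp_comp S (w s) @\<^sub>v disp_comp S (\<nu> s))) (int t - 1)"
  let ?C = "N + 4 / \<beta>"
  have carr: "x s \<in> carrier_vec N" "z s \<in> carrier_vec N" for s using sol by (auto simp: solution_tuple_def)
  have Npos: "0 < real N" using N by simp
  have \<mu>: "0 \<le> \<mu>" "\<mu> < 1" using small_step(2)[OF \<gamma>] \<gamma> c Npos by (simp_all add: \<mu>_def field_simps)
  have C: "0 \<le> ?C" using \<beta>_pos by simp
  have "lyap \<gamma> (x t) (z t) \<le> \<mu> ^ t * lyap \<gamma> (x 0) (z 0) + (?a + 2 * \<beta> * ?p) / (1 - \<mu>)"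
    using \<mu> \<beta>_pos lyap_step[OF \<gamma> sol] unfolding \<mu>_def[symmetric]
    by (intro contraction_with_inputs[where V="\<lambda>t. lyap \<gamma> (x t) (z t)"]) auto
  also have "\<dots> \<le> \<mu> ^ t * ((1 + 2 * \<beta>) * opt_dist \<gamma> (x 0) (z 0)) + (?a + 2 * \<beta> * ?p) / (1 - \<mu>)"
    using \<mu> by (intro add_right_mono mult_left_mono lyap_le_opt_dist carr) auto
  finally have "?C * lyap \<gamma> (x t) (z t) \<le> ?C * (\<mu> ^ t * ((1 + 2 * \<beta>) * opt_dist \<gamma> (x 0) (z 0)) + (?a + 2 * \<beta> * ?p) / (1 - \<mu>))"
    using C by (intro mult_left_mono)
  also have "\<dots> = ?C * (1 + 2 * \<beta>) * \<mu> ^ t * opt_dist \<gamma> (x 0) (z 0) + \<rho> * ?a + \<rho> * (2 * \<beta>) * ?p"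
  proof -
    have "C * (m * (e * d) + (a + b * p) / h) = C * e * m * d + C / h * a + C / h * b * p"
      for C m e d a b p h :: real
      by (simp add: algebra_simps add_divide_distrib)
    then show ?thesis unfolding \<rho>_def .
  qed
  finally show ?thesis using opt_dist_le_lyap[OF carr(1)[of t] carr(2)[of t], of \<gamma>] by linarith
qed

section \<open>Bounded perturbations\<close>

lemma bounded_solution:
  assumes \<gamma>: "0 < \<gamma>" "\<gamma> < \<gamma>\<^sub>0" and sol: "solution_tuple N K f \<gamma> x z w \<nu>"
    and "vec_seq_bounded w" "vec_seq_bounded \<nu>"
  shows "vec_seq_bounded x" "vec_seq_bounded (\<lambda>t. disp_comp S (z t))"
proof -
  have carr: "x t \<in> carrier_vec N" "z t \<in> carrier_vec N" "w t \<in> carrier_vec N" "\<nu> t \<in> carrier_vec N" for t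
    using sol by (auto simp: solution_tuple_def)
  obtain W V where W: "0 < W" "\<And>t. eucl_norm (w t) \<le> W" and V: "0 < V" "\<And>t. eucl_norm (\<nu> t) \<le> V"
    using assms(4,5) by (elim vec_seq_boundedE) blast
  define \<mu> where "\<mu> = 1 - \<gamma> * c / (2 * N)"
  define \<rho> where "\<rho> = (N + 4 / \<beta>) / (1 - \<mu>)"
  define C where "C = (N + 4 / \<beta>) * (1 + 2 * \<beta>)"
  define D where "D = C * opt_dist \<gamma> (x 0) (z 0) + \<rho> * W + \<rho> * (2 * \<beta>) * (W + V)"
  have Npos: "0 < real N" using N by simp
  have \<mu>: "0 \<le> \<mu>" "\<mu> < 1" using small_step(2)[OF \<gamma>] \<gamma> c Npos by (simp_all add: \<mu>_def field_simps)
  have pos: "0 \<le> \<rho>" "0 \<le> C" "0 \<le> opt_dist \<gamma> (x 0) (z 0)"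
    using \<mu> \<beta>_pos carr by (simp_all add: \<rho>_def C_def opt_dist_eq)
  have a: "\<bar>avg_comp N (w t)\<bar> \<le> W" for t using abs_avg_comp_le[OF carr(3)] W(2) by (rule order_trans)
  have p: "eucl_norm (disp_comp S (w t) @\<^sub>v disp_comp S (\<nu> t)) \<le> W + V" for t
  proof -
    have "eucl_norm (disp_comp S (w t) @\<^sub>v disp_comp S (\<nu> t)) \<le> eucl_norm (w t) + eucl_norm (\<nu> t)"
      using eucl_norm_append_le[of "disp_comp S (w t)" "disp_comp S (\<nu> t)"]
        eucl_norm_mean_free_le[OF carr(3), of t] eucl_norm_mean_free_le[OF carr(4), of t]
      by (simp add: eucl_norm_disp_comp carr)
    then show ?thesis using W(2)[of t] V(2)[of t] by linarith
  qed
  have D: "opt_dist \<gamma> (x t) (z t) \<le> D" for t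
  proof -
    have "C * \<mu> ^ t * opt_dist \<gamma> (x 0) (z 0) \<le> C * 1 * opt_dist \<gamma> (x 0) (z 0)"
      using \<mu> pos by (intro mult_right_mono mult_left_mono power_le_one) auto
    moreover have "\<rho> * running_sup (\<lambda>s. \<bar>avg_comp N (w s)\<bar>) (int t - 1) \<le> \<rho> * W"
      using pos a W by (intro mult_left_mono running_sup_le) auto
    moreover have "\<rho> * (2 * \<beta>) * running_sup (\<lambda>s. eucl_norm (disp_comp S (w s) @\<^sub>v disp_comp S (\<nu> s))) (int t - 1)
        \<le> \<rho> * (2 * \<beta>) * (W + V)"
      using pos p W V \<beta>_pos by (intro mult_left_mono running_sup_le) auto
    ultimately show ?thesis
      using opt_dist_estimate[OF \<gamma> sol, of t]
      unfolding \<mu>_def[symmetric] \<rho>_def[symmetric] C_def[symmetric] D_def by linarith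
  qed
  show "vec_seq_bounded x"
  proof (rule vec_seq_boundedI)
    fix t
    have "x t = primal_err (x t) + \<theta> \<cdot>\<^sub>v ones_vec N" using carr by (intro eq_vecI) (auto simp: carrier_vecD[OF carr(1)])
    then have "eucl_norm (x t) \<le> eucl_norm (primal_err (x t)) + eucl_norm (\<theta> \<cdot>\<^sub>v ones_vec N)"
      using eucl_norm_triangle[of "primal_err (x t)" N "\<theta> \<cdot>\<^sub>v ones_vec N"] carr by simp
    also have "eucl_norm (primal_err (x t)) \<le> opt_dist \<gamma> (x t) (z t)"
      unfolding opt_dist_eq[OF carr(1,2)] by (rule eucl_norm_le_append)
    also note D[of t]
    finally show "eucl_norm (x t) \<le> D + eucl_norm (\<theta> \<cdot>\<^sub>v ones_vec N)" by simp
  qed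
  show "vec_seq_bounded (\<lambda>t. disp_comp S (z t))"
  proof (rule vec_seq_boundedI)
    fix t
    have "mean_free N (z t) = dual_err \<gamma> (z t) + dual_offset f \<gamma> \<theta>"
      by (intro eq_vecI) (auto simp: carrier_vecD[OF dual_offset_carrier])
    then have "eucl_norm (disp_comp S (z t)) \<le> eucl_norm (dual_err \<gamma> (z t)) + eucl_norm (dual_offset f \<gamma> \<theta>)"
      using eucl_norm_triangle[of "dual_err \<gamma> (z t)" N "dual_offset f \<gamma> \<theta>"] carr
      by (simp add: eucl_norm_disp_comp)
    also have "eucl_norm (dual_err \<gamma> (z t)) \<le> opt_dist \<gamma> (x t) (z t)"
      unfolding opt_dist_eq[OF carr(1,2)] by (rule eucl_norm_le_append)
    also note D[of t]
    finally show "eucl_norm (disp_comp S (z t)) \<le> D + eucl_norm (dual_offset f \<gamma> \<theta>)" by simp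
  qed
qed

text \<open>
  The values of K are mean-free, so the mean of z sums up the means of \<nu>, whatever x does.
\<close>

lemma average_dual_bounded_iff:
  assumes sol: "solution_tuple N K f \<gamma> x z w \<nu>"
  shows "Bseq (\<lambda>t. avg_comp N (z t)) \<longleftrightarrow> integral_average_bounded N \<nu>"
proof -
  have step: "avg_comp N (z (Suc t)) = avg_comp N (z t) + avg_comp N (\<nu> t)" for t
  proof -
    have s: "x t \<in> carrier_vec N" "z t \<in> carrier_vec N" "\<nu> t \<in> carrier_vec N" "z (Suc t) = z t + K *\<^sub>v x t + \<nu> t"
      using sol by (auto simp: solution_tuple_def)
    then show ?thesis using avg_comp_0[OF ones_K[OF s(1)]] by (simp add: avg_comp_add)
  qed
  have sum: "avg_comp N (z (Suc t)) = (\<Sum>s=0..t. avg_comp N (\<nu> s)) + avg_comp N (z 0)" for t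
    by (induction t) (simp_all add: step)
  have "Bseq (\<lambda>t. avg_comp N (z t)) \<longleftrightarrow> Bseq (\<lambda>t. avg_comp N (z (Suc t)))"
    by (rule Bseq_Suc_iff[symmetric])
  also have "\<dots> \<longleftrightarrow> integral_average_bounded N \<nu>"
    unfolding sum integral_average_bounded_def by (rule Bseq_add_iff)
  finally show ?thesis .
qed

lemma pair_bounded_iff:
  assumes carr: "\<And>t. x t \<in> carrier_vec N" "\<And>t. z t \<in> carrier_vec N"
    and "vec_seq_bounded x" "vec_seq_bounded (\<lambda>t. disp_comp S (z t))"
  shows "vec_seq_bounded (\<lambda>t. x t @\<^sub>v z t) \<longleftrightarrow> Bseq (\<lambda>t. avg_comp N (z t))"
proof
  assume "vec_seq_bounded (\<lambda>t. x t @\<^sub>v z t)"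
  then obtain B where B: "\<And>t. eucl_norm (x t @\<^sub>v z t) \<le> B" by (elim vec_seq_boundedE) blast
  show "Bseq (\<lambda>t. avg_comp N (z t))"
  proof (rule BseqI')
    fix t
    show "norm (avg_comp N (z t)) \<le> B"
      using abs_avg_comp_le[OF carr(2), of t] eucl_norm_le_append(2)[where u="x t" and v="z t"] B[of t] by simp
  qed
next
  assume "Bseq (\<lambda>t. avg_comp N (z t))"
  then obtain A where A: "\<And>t. \<bar>avg_comp N (z t)\<bar> \<le> A" by (elim BseqE) auto
  obtain X Z where X: "\<And>t. eucl_norm (x t) \<le> X" and Z: "\<And>t. eucl_norm (disp_comp S (z t)) \<le> Z"
    using assms(3,4) by (elim vec_seq_boundedE) blast
  show "vec_seq_bounded (\<lambda>t. x t @\<^sub>v z t)"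
  proof (rule vec_seq_boundedI)
    fix t
    have "N * \<bar>avg_comp N (z t)\<bar> \<le> N * A" using A by (intro mult_left_mono) auto
    then show "eucl_norm (x t @\<^sub>v z t) \<le> X + (N * A + Z)"
      using eucl_norm_append_le[of "x t" "z t"] eucl_norm_le_avg_mean_free[OF carr(2), of t] X[of t] Z[of t]
      by (simp add: eucl_norm_disp_comp carr)
  qed
qed

end

section \<open>Convergence estimate and boundedness\<close>

theorem theorem1:
  fixes N :: nat
    and E :: "(nat \<times> nat) set"
    and k :: "nat \<Rightarrow> nat \<Rightarrow> real"
    and K S :: "real mat"
    and f :: "nat \<Rightarrow> real \<Rightarrow> real"
  assumes "N \<ge> 1"
    and "connected_simple_graph N E"
    and "\<And>i j. (i, j) \<in> E \<Longrightarrow> k i j = k j i \<and> k i j > 0"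
    and "K = weighted_laplacian N E k"
    and "dispersion_basis N S"
    and "\<And>i. i < N \<Longrightarrow> C1_lipschitz_deriv (f i)"
    and "strongly_convex (\<lambda>\<theta>. \<Sum>i<N. f i \<theta>)"
    and "K = K\<^sup>T"
    and "mat_kernel K = {c \<cdot>\<^sub>v ones_vec N | c. True}"
    and "spectrum (map_mat complex_of_real K) \<subseteq> complex_of_real ` {0..<1}"
  shows "\<exists>\<gamma>\<^sub>s>0. \<exists>\<alpha>>0. \<forall>\<gamma>\<in>{0<..<\<gamma>\<^sub>s}.
    (\<exists>\<mu>\<in>{0..<1}. \<exists>\<rho>>0. \<exists>\<tau>>0. \<forall>x z w \<nu>. solution_tuple N K f \<gamma> x z w \<nu> \<longrightarrow>
      (\<forall>t. dist_to_set (x t @\<^sub>v z t) (target_set N K f S \<gamma>)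
         \<le> \<alpha> * \<mu> ^ t * dist_to_set (x 0 @\<^sub>v z 0) (target_set N K f S \<gamma>)
           + \<rho> * running_sup (\<lambda>s. \<bar>avg_comp N (w s)\<bar>) (int t - 1)
           + \<tau> * running_sup (\<lambda>s. eucl_norm (disp_comp S (w s) @\<^sub>v disp_comp S (\<nu> s))) (int t - 1))) \<and>
    (\<forall>x z w \<nu>. solution_tuple N K f \<gamma> x z w \<nu> \<and> vec_seq_bounded w \<and> vec_seq_bounded \<nu> \<longrightarrow>
      vec_seq_bounded x \<and> vec_seq_bounded (\<lambda>t. disp_comp S (z t)) \<and>
      (Bseq (\<lambda>t. avg_comp N (z t)) \<longleftrightarrow> integral_average_bounded N \<nu>) \<and>
      (vec_seq_bounded (\<lambda>t. x t @\<^sub>v z t) \<longleftrightarrow> integral_average_bounded N \<nu>))"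
proof -
  have Kc: "K \<in> carrier_mat N N" using assms(4) by (simp add: weighted_laplacian_def)
  interpret consensus N K S
    using assms Kc by unfold_locales auto
  have "\<exists>l. l-lipschitz_on UNIV (deriv (f i))" if "i < N" for i
    using assms(6)[OF that] by (auto simp: C1_lipschitz_deriv_def)
  then obtain l where l: "\<And>i. i < N \<Longrightarrow> (l i)-lipschitz_on UNIV (deriv (f i))" by metis
  define L where "L = (\<Sum>i<N. l i)"
  have l0: "0 \<le> l i" if "i < N" for i using l[OF that] by (rule lipschitz_on_nonneg)
  have L: "0 \<le> L" unfolding L_def using l0 by (intro sum_nonneg) auto
  have lip: "\<bar>deriv (f i) s - deriv (f i) r\<bar> \<le> L * \<bar>s - r\<bar>" if "i < N" for i s r
  proof -
    have "\<bar>deriv (f i) s - deriv (f i) r\<bar> \<le> l i * \<bar>s - r\<bar>"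
      using lipschitz_onD[OF l[OF that], of s r] by (simp add: dist_real_def)
    also have "\<dots> \<le> L * \<bar>s - r\<bar>"
      unfolding L_def using that l0 by (intro mult_right_mono member_le_sum) auto
    finally show ?thesis .
  qed
  have diff: "(f i has_real_derivative deriv (f i) s) (at s)" if "i < N" for i s
    using assms(6)[OF that] by (simp add: C1_lipschitz_deriv_def DERIV_deriv_iff_field_differentiable)
  have "((\<lambda>\<theta>. \<Sum>i<N. f i \<theta>) has_real_derivative (\<Sum>i<N. deriv (f i) s)) (at s)" for s
    using diff by (intro DERIV_sum) auto
  then obtain c where c: "0 < c" and mono: "\<And>s r. c * (s - r)\<^sup>2 \<le> ((\<Sum>i<N. deriv (f i) s) - (\<Sum>i<N. deriv (f i) r)) * (s - r)"
    using strongly_convex_imp_deriv_strongly_monotone[OF assms(7)] by metis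
  have "continuous_on UNIV (\<lambda>s. \<Sum>i<N. deriv (f i) s)"
    using assms(6) by (intro continuous_on_sum) (auto simp: C1_lipschitz_deriv_def)
  then obtain \<theta> where \<theta>: "\<And>\<eta>. (\<Sum>i<N. deriv (f i) \<eta>) = 0 \<longleftrightarrow> \<eta> = \<theta>"
    using strongly_monotone_unique_zero[OF _ c mono] by metis
  obtain \<delta> where \<delta>: "0 < \<delta>" "\<delta> \<le> 1" and gap: "\<And>y. y \<in> carrier_vec N \<Longrightarrow> ones_vec N \<bullet> y = 0 \<Longrightarrow>
    \<delta> * (y \<bullet> y) \<le> y \<bullet> (K *\<^sub>v y) - (K *\<^sub>v y) \<bullet> (K *\<^sub>v y)"
    using consensus_gap[OF K K_sym kerK specK] by metis
  interpret gradient_tracking N K S f L c \<theta> \<delta>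
    using L lip c mono \<theta> \<delta> gap by unfold_locales auto
  define \<alpha> where "\<alpha> = (N + 4 / \<beta>) * (1 + 2 * \<beta>)"
  show ?thesis
  proof (rule exI[of _ \<gamma>\<^sub>0], intro conjI \<gamma>\<^sub>0_pos, rule exI[of _ \<alpha>], intro conjI ballI)
    show "0 < \<alpha>" using \<beta>_pos N by (auto simp: \<alpha>_def intro!: mult_pos_pos add_pos_pos)
    fix \<gamma> assume "\<gamma> \<in> {0<..<\<gamma>\<^sub>0}"
    then have \<gamma>: "0 < \<gamma>" "\<gamma> < \<gamma>\<^sub>0" by auto
    define \<mu> where "\<mu> = 1 - \<gamma> * c / (2 * N)"
    define \<rho> where "\<rho> = (N + 4 / \<beta>) / (1 - \<mu>)"
    have \<mu>: "\<mu> \<in> {0..<1}" using small_step(2)[OF \<gamma>] \<gamma> c N by (simp add: \<mu>_def field_simps)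
    have \<rho>: "0 < \<rho>" "0 < \<rho> * (2 * \<beta>)"
      using \<mu> \<beta>_pos N by (auto simp: \<rho>_def intro!: mult_pos_pos divide_pos_pos add_pos_pos)
    show "\<exists>\<mu>\<in>{0..<1}. \<exists>\<rho>>0. \<exists>\<tau>>0. \<forall>x z w \<nu>. solution_tuple N K f \<gamma> x z w \<nu> \<longrightarrow>
      (\<forall>t. dist_to_set (x t @\<^sub>v z t) (target_set N K f S \<gamma>)
         \<le> \<alpha> * \<mu> ^ t * dist_to_set (x 0 @\<^sub>v z 0) (target_set N K f S \<gamma>)
           + \<rho> * running_sup (\<lambda>s. \<bar>avg_comp N (w s)\<bar>) (int t - 1)
           + \<tau> * running_sup (\<lambda>s. eucl_norm (disp_comp S (w s) @\<^sub>v disp_comp S (\<nu> s))) (int t - 1))"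
    proof (rule bexI[OF _ \<mu>], rule exI[of _ \<rho>], rule conjI[OF \<rho>(1)],
        rule exI[of _ "\<rho> * (2 * \<beta>)"], rule conjI[OF \<rho>(2)], intro allI impI)
      fix x z w \<nu> t assume sol: "solution_tuple N K f \<gamma> x z w \<nu>"
      show "dist_to_set (x t @\<^sub>v z t) (target_set N K f S \<gamma>)
         \<le> \<alpha> * \<mu> ^ t * dist_to_set (x 0 @\<^sub>v z 0) (target_set N K f S \<gamma>)
           + \<rho> * running_sup (\<lambda>s. \<bar>avg_comp N (w s)\<bar>) (int t - 1)
           + \<rho> * (2 * \<beta>) * running_sup (\<lambda>s. eucl_norm (disp_comp S (w s) @\<^sub>v disp_comp S (\<nu> s))) (int t - 1)"
        using opt_dist_estimate[OF \<gamma> sol, of t]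
        unfolding opt_dist_def \<mu>_def[symmetric] \<rho>_def[symmetric] \<alpha>_def[symmetric] .
    qed
    show "\<forall>x z w \<nu>. solution_tuple N K f \<gamma> x z w \<nu> \<and> vec_seq_bounded w \<and> vec_seq_bounded \<nu> \<longrightarrow>
      vec_seq_bounded x \<and> vec_seq_bounded (\<lambda>t. disp_comp S (z t)) \<and>
      (Bseq (\<lambda>t. avg_comp N (z t)) \<longleftrightarrow> integral_average_bounded N \<nu>) \<and>
      (vec_seq_bounded (\<lambda>t. x t @\<^sub>v z t) \<longleftrightarrow> integral_average_bounded N \<nu>)"
    proof (intro allI impI)
      fix x z w \<nu> assume "solution_tuple N K f \<gamma> x z w \<nu> \<and> vec_seq_bounded w \<and> vec_seq_bounded \<nu>"
      then have sol: "solution_tuple N K f \<gamma> x z w \<nu>" and b: "vec_seq_bounded w" "vec_seq_bounded \<nu>" by auto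
      have carr: "x t \<in> carrier_vec N" "z t \<in> carrier_vec N" for t
        using sol by (auto simp: solution_tuple_def)
      note bd = bounded_solution[OF \<gamma> sol b]
      show "vec_seq_bounded x \<and> vec_seq_bounded (\<lambda>t. disp_comp S (z t)) \<and>
        (Bseq (\<lambda>t. avg_comp N (z t)) \<longleftrightarrow> integral_average_bounded N \<nu>) \<and>
        (vec_seq_bounded (\<lambda>t. x t @\<^sub>v z t) \<longleftrightarrow> integral_average_bounded N \<nu>)"
        using bd pair_bounded_iff[OF carr bd] average_dual_bounded_iff[OF sol] by simp
    qed
  qed
qed

end
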